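(* Let $\mathcal{S}=\{(\alpha,\beta,\gamma)\mid \alpha,\beta,\gamma>0,\ \alpha+\beta+\gamma=\pi\}$ be the shape space of triangles and consider the vector field induced on it by $\xi$. This field has an integral $$I:=\frac{\mathcal{P}^2}{4\mathcal{A}}=\cot\frac{\alpha}{2}+\cot\frac{\beta}{2}+\cot\frac{\gamma}{2}=\cot\frac{\alpha}{2}\cot\frac{\beta}{2}\cot\frac{\gamma}{2},$$ where $\mathcal{P}$ and $\mathcal{A}$ are the perimeter and the area of a triangle with angles $\alpha,\beta,\gamma$. It has a unique zero, at the point $\alpha=\beta=\gamma=\pi/3$, and all its trajectories are closed.
   Context: For a non-degenerate triangle $\mathbf{P}=(P_1,P_2,P_3)$ in the plane (indices cyclic mod 3), the vector field $\xi$ moves the vertex $P_i$ with velocity $$\xi_i=\frac12\left(\frac{P_i-P_{i-1}}{|P_i-P_{i-1}|}-\frac{P_i-P_{i+1}}{|P_i-P_{i+1}|}\right).$$ The field $\xi$ commutes with translations and rotations and preserves the area of a triangle. The shape space $\mathcal{S}$ is the space of orientation-preserving isometry classes of triangles (of fixed orientation) with a fixed, say unit, area, parametrized by the angles $\alpha,\beta,\gamma$ at $P_1,P_2,P_3$; $\xi$ restricted to triangles of that fixed area descends to a vector field on $\mathcal{S}$. *)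

theory Defs
  imports "HOL-Analysis.Analysis"
begin

text \<open>
  A triangle is a triple of points of the plane, indexed by the type \<^typ>\<open>3\<close>. Arithmetic on
  that type is modulo 3, so \<open>i - 1\<close> and \<open>i + 1\<close> are the cyclic neighbours of \<open>i\<close>.
\<close>

type_synonym triangle = "real^2^3"

definition nondegenerate :: "triangle \<Rightarrow> bool" where
  "nondegenerate P \<longleftrightarrow> \<not> collinear {P $ 1, P $ 2, P $ 3}"

definition counterclockwise :: "triangle \<Rightarrow> bool" where
  "counterclockwise P \<longleftrightarrow> det (vector [P $ 2 - P $ 1, P $ 3 - P $ 1] :: real^2^2) > 0"

definition area :: "triangle \<Rightarrow> real" where
  "area P = measure lborel (convex hull {P $ 1, P $ 2, P $ 3})"

definition perimeter :: "triangle \<Rightarrow> real" where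
  "perimeter P = (\<Sum>i\<in>UNIV. dist (P $ i) (P $ (i + 1)))"

definition vertex_angle :: "'a::real_inner \<Rightarrow> 'a \<Rightarrow> 'a \<Rightarrow> real" where
  "vertex_angle A B C = arccos (((A - B) \<bullet> (C - B)) / (norm (A - B) * norm (C - B)))"

definition angles :: "triangle \<Rightarrow> real^3" where
  "angles P = (\<chi> i. vertex_angle (P $ (i - 1)) (P $ i) (P $ (i + 1)))"

definition xi :: "triangle \<Rightarrow> triangle" where
  "xi P = (\<chi> i. (1/2) *\<^sub>R ((P $ i - P $ (i - 1)) /\<^sub>R norm (P $ i - P $ (i - 1))
                      - (P $ i - P $ (i + 1)) /\<^sub>R norm (P $ i - P $ (i + 1))))"

definition unit_triangles :: "triangle set" where
  "unit_triangles = {P. nondegenerate P \<and> counterclockwise P \<and> area P = 1}"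

definition shape_space :: "(real^3) set" where
  "shape_space = {s. s $ 1 > 0 \<and> s $ 2 > 0 \<and> s $ 3 > 0 \<and> s $ 1 + s $ 2 + s $ 3 = pi}"

text \<open>
  The value at the shape \<open>s\<close> of a function \<open>F\<close> on the set \<open>T\<close> of triangles that depends only on
  the angles. It is unspecified when \<open>F\<close> is not constant on the fibre over \<open>s\<close>.
\<close>

definition descend :: "triangle set \<Rightarrow> (triangle \<Rightarrow> 'a) \<Rightarrow> real^3 \<Rightarrow> 'a" where
  "descend T F s = the_elem (F ` {P \<in> T. angles P = s})"

text \<open>
  The push-forward of \<^const>\<open>xi\<close> along \<^const>\<open>angles\<close>: its value at a shape is the velocity of the
  angles when a unit-area representative of the shape moves with velocity \<^const>\<open>xi\<close>.
\<close>

definition shape_field :: "real^3 \<Rightarrow> real^3" where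
  "shape_field = descend unit_triangles (\<lambda>P. frechet_derivative angles (at P) (xi P))"

definition shape_I :: "real^3 \<Rightarrow> real" where
  "shape_I = descend {P. nondegenerate P} (\<lambda>P. (perimeter P)\<^sup>2 / (4 * area P))"

definition integral_curve ::
    "('a::real_normed_vector \<Rightarrow> 'a) \<Rightarrow> 'a set \<Rightarrow> real set \<Rightarrow> (real \<Rightarrow> 'a) \<Rightarrow> bool" where
  "integral_curve X S J c \<longleftrightarrow> open J \<and> is_interval J \<and> J \<noteq> {} \<and>
     (\<forall>t\<in>J. c t \<in> S \<and> (c has_vector_derivative X (c t)) (at t))"

definition trajectory ::
    "('a::real_normed_vector \<Rightarrow> 'a) \<Rightarrow> 'a set \<Rightarrow> real set \<Rightarrow> (real \<Rightarrow> 'a) \<Rightarrow> bool" where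
  "trajectory X S J c \<longleftrightarrow> integral_curve X S J c \<and>
     (\<forall>J' c'. integral_curve X S J' c' \<and> J \<subseteq> J' \<and> (\<forall>t\<in>J. c' t = c t) \<longrightarrow> J' = J)"

text \<open>An equilibrium counts as a (constant) closed trajectory.\<close>

definition closed_trajectory :: "real set \<Rightarrow> (real \<Rightarrow> 'a) \<Rightarrow> bool" where
  "closed_trajectory J c \<longleftrightarrow> J = UNIV \<and> (\<exists>T>0. \<forall>t. c (t + T) = c t)"

definition first_integral ::
    "('a::real_normed_vector \<Rightarrow> 'a) \<Rightarrow> 'a set \<Rightarrow> ('a \<Rightarrow> real) \<Rightarrow> bool" where
  "first_integral X S f \<longleftrightarrow> \<not> f constant_on S \<and>
     (\<forall>J c. integral_curve X S J c \<longrightarrow> (\<lambda>t. f (c t)) constant_on J)"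

end

theory Submission
  imports Defs
begin

text \<open>
  If \<open>R\<close> is the circumradius, then \<open>\<xi>\<close> changes the angle \<open>\<alpha>\<close> with velocity
  \<open>(sin \<alpha> + sin \<beta> + sin \<gamma>) (1 / sin \<beta> - 1 / sin \<gamma>) / (4 R)\<close>. For unit area this equals
  \<open>\<surd>I / 2 \<cdot> sin \<alpha> (sin \<gamma> - sin \<beta>)\<close>. Hence \<open>(ln cot (\<alpha>/2))' = - \<surd>I / 2 \<cdot> (sin \<gamma> - sin \<beta>)\<close>, and the sum of
  these over the three angles vanishes, so \<open>I\<close> is preserved.

  With \<open>x, y, z\<close> the cotangents of the half angles, a level set is \<open>x y z = x + y + z = h\<close> with \<open>x, y, z > 0\<close>.
  It is a point for \<open>h\<^sup>2 = 27\<close>; otherwise it is an oval of a cubic curve, which is parametrized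
  smoothly and periodically by an angle \<open>\<phi>\<close> so that the field becomes \<open>\<phi>' = g(\<phi>)\<close> with
  \<open>g\<close> positive and periodic. This gives a periodic integral curve through every point, and by
  uniqueness every trajectory is one of them.
\<close>

section \<open>Angles of plane triangles\<close>

definition cross2 :: "real^2 \<Rightarrow> real^2 \<Rightarrow> real" where
  "cross2 u v = u $ 1 * v $ 2 - u $ 2 * v $ 1"

text \<open>Lagrange's identity in the plane, that is, \<open>sin^2 + cos^2 = 1\<close> scaled by
  the two lengths.\<close>

lemma cross2_sq: "(cross2 u v)\<^sup>2 + (u \<bullet> v)\<^sup>2 = (norm u)\<^sup>2 * (norm v)\<^sup>2"
  unfolding power2_norm_eq_inner
  by (simp add: cross2_def inner_vec_def sum_2) algebra

text \<open>Collinearity is the equality case of Cauchy-Schwarz, and by \<open>cross2_sq\<close> the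
  defect in that inequality is the square of \<open>cross2\<close>.\<close>

lemma collinear_iff_cross2: "collinear {A, B, C} \<longleftrightarrow> cross2 (A - B) (C - B) = 0"
proof -
  have "collinear {A, B, C} \<longleftrightarrow> \<bar>(A - B) \<bullet> (C - B)\<bar> = norm (A - B) * norm (C - B)"
    by (simp add: collinear_3 norm_cauchy_schwarz_equal)
  also have "\<dots> \<longleftrightarrow> ((A - B) \<bullet> (C - B))\<^sup>2 = (norm (A - B) * norm (C - B))\<^sup>2"
    by (metis abs_ge_zero mult_nonneg_nonneg norm_ge_zero power2_abs power2_eq_iff_nonneg)
  also have "\<dots> \<longleftrightarrow> cross2 (A - B) (C - B) = 0"
    using cross2_sq[of "A - B" "C - B"] by (auto simp: power_mult_distrib)
  finally show ?thesis .
qed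

text \<open>By \<open>cross2_sq\<close>, \<open>1 - q^2\<close> is the square of
  \<open>cross2 u v / (norm u * norm v)\<close>. A nonzero cross product thus keeps \<open>q\<close>
  strictly between -1 and 1, where \<open>arccos\<close> is differentiable, and gives the sine as
  the positive root.\<close>

lemma arccos_inner:
  fixes u v :: "real^2"
  defines "q \<equiv> (u \<bullet> v) / (norm u * norm v)"
  assumes "cross2 u v \<noteq> 0"
  shows "norm u > 0" "norm v > 0" "-1 < q" "q < 1" "0 < arccos q" "arccos q < pi"
    "cos (arccos q) = q" "sin (arccos q) = \<bar>cross2 u v\<bar> / (norm u * norm v)"
proof -
  show nz: "norm u > 0" "norm v > 0"
    using assms(2) by (auto simp: cross2_def)
  have "(\<bar>cross2 u v\<bar> / (norm u * norm v))\<^sup>2 = 1 - q\<^sup>2"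
    using nz cross2_sq[of u v] by (simp add: q_def field_simps)
  moreover have pos: "\<bar>cross2 u v\<bar> / (norm u * norm v) > 0"
    using nz assms(2) by simp
  ultimately have sq: "q\<^sup>2 < 1" and
    rt: "sqrt (1 - q\<^sup>2) = \<bar>cross2 u v\<bar> / (norm u * norm v)"
    by (metis diff_gt_0_iff_gt zero_less_power, metis real_sqrt_unique less_imp_le)
  from sq show q: "-1 < q" "q < 1"
    by (auto simp: power2_less_1_iff abs_less_iff abs_square_less_1)
  then show "0 < arccos q" "arccos q < pi" "cos (arccos q) = q"
    using arccos_lt_bounded[of q] by auto
  show "sin (arccos q) = \<bar>cross2 u v\<bar> / (norm u * norm v)"
    using q rt by (simp add: sin_arccos)
qed

text \<open>The cosine makes the sum an odd multiple of pi, and the bounds place it strictly between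
  0 and 3 pi.\<close>

lemma sum_eq_pi:
  fixes \<alpha> \<beta> \<gamma> :: real
  assumes "0 < \<alpha>" "\<alpha> < pi" "0 < \<beta>" "\<beta> < pi" "0 < \<gamma>" "\<gamma> < pi" "cos (\<alpha> + \<beta> + \<gamma>) = - 1"
  shows "\<alpha> + \<beta> + \<gamma> = pi"
proof -
  have "cos (\<alpha> + \<beta> + \<gamma> - pi) = 1" using assms by simp
  then obtain n :: int where n: "\<alpha> + \<beta> + \<gamma> - pi = of_int n * (2 * pi)"
    by (metis cos_one_2pi_int mult.assoc)
  have "of_int n * (2 * pi) < 1 * (2 * pi)" "(-1) * (2 * pi) < of_int n * (2 * pi)"
    using n assms pi_gt_zero by linarith+
  then have "of_int n < (1::real)" "(-1::real) < of_int n"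
    by (metis mult_less_cancel_right_pos pi_gt_zero zero_less_mult_iff zero_less_numeral)+
  then have "n = 0" by linarith
  with n show ?thesis by simp
qed

text \<open>Here \<open>D\<close> is twice the area. The law of cosines and the area formula yield
  \<open>cos (\<alpha> + \<beta>) = - cos \<gamma>\<close> and
  \<open>sin (\<alpha> + \<beta>) = sin \<gamma>\<close>, hence
  \<open>cos (\<alpha> + \<beta> + \<gamma>) = - 1\<close>.\<close>

lemma law_of_cosines_sum:
  fixes a b c D \<alpha> \<beta> \<gamma> :: real
  assumes pos: "a > 0" "b > 0" "c > 0"
    and \<alpha>: "0 < \<alpha>" "\<alpha> < pi" "cos \<alpha> = (b\<^sup>2 + c\<^sup>2 - a\<^sup>2) / (2 * b * c)" "sin \<alpha> = D / (b * c)"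
    and \<beta>: "0 < \<beta>" "\<beta> < pi" "cos \<beta> = (c\<^sup>2 + a\<^sup>2 - b\<^sup>2) / (2 * c * a)" "sin \<beta> = D / (c * a)"
    and \<gamma>: "0 < \<gamma>" "\<gamma> < pi" "cos \<gamma> = (a\<^sup>2 + b\<^sup>2 - c\<^sup>2) / (2 * a * b)" "sin \<gamma> = D / (a * b)"
  shows "\<alpha> + \<beta> + \<gamma> = pi"
proof -
  \<comment> \<open>At the angle \<gamma> this is Heron's formula; it eliminates \<open>D\<close>
    from the cosine computation below.\<close>
  have "(sin \<gamma>)\<^sup>2 + (cos \<gamma>)\<^sup>2 = 1" by simp
  then have D: "4 * D\<^sup>2 = 4 * a\<^sup>2 * b\<^sup>2 - (a\<^sup>2 + b\<^sup>2 - c\<^sup>2)\<^sup>2"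
    using pos unfolding \<gamma> by (simp add: field_simps)
  have "cos (\<alpha> + \<beta>) = ((b\<^sup>2 + c\<^sup>2 - a\<^sup>2) * (c\<^sup>2 + a\<^sup>2 - b\<^sup>2) - 4 * D\<^sup>2) / (4 * a * b * c\<^sup>2)"
    using pos by (simp add: cos_add \<alpha> \<beta> field_simps power2_eq_square)
  also have "\<dots> = ((c\<^sup>2 - a\<^sup>2 - b\<^sup>2) * (2 * c\<^sup>2)) / (4 * a * b * c\<^sup>2)"
    unfolding D by (rule arg_cong[where f="\<lambda>x. x / _"]) algebra
  also have "\<dots> = - cos \<gamma>"
    using pos by (simp add: \<gamma> field_simps)
  finally have c: "cos (\<alpha> + \<beta>) = - cos \<gamma>" .
  have s: "sin (\<alpha> + \<beta>) = sin \<gamma>"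
    using pos by (simp add: sin_add \<alpha> \<beta> \<gamma> field_simps power2_eq_square)
  have "cos (\<alpha> + \<beta> + \<gamma>) = - ((sin \<gamma>)\<^sup>2 + (cos \<gamma>)\<^sup>2)"
    unfolding cos_add[of "\<alpha> + \<beta>"] c s by (simp add: power2_eq_square)
  then have "cos (\<alpha> + \<beta> + \<gamma>) = - 1" by simp
  then show ?thesis using \<alpha> \<beta> \<gamma> by (intro sum_eq_pi)
qed

lemma cot_half:
  fixes x :: real
  assumes "sin x \<noteq> 0"
  shows "cot (x / 2) = (1 + cos x) / sin x"
proof -
  have 1: "sin x = 2 * sin (x / 2) * cos (x / 2)" "cos x = 2 * (cos (x / 2))\<^sup>2 - 1"
    using sin_double[of "x/2"] cos_double_cos[of "x/2"] by simp_all
  with assms have "sin (x/2) \<noteq> 0" "cos (x/2) \<noteq> 0" by auto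
  then show ?thesis unfolding 1 by (simp add: cot_def field_simps power2_eq_square)
qed

lemma cyclic3: "(1::3) - 1 = 3" "(2::3) - 1 = 1" "(3::3) - 1 = 2"
    "(1::3) + 1 = 2" "(2::3) + 1 = 3" "(3::3) + 1 = 1"
  by simp_all

section \<open>Angles, perimeter and area of a triangle\<close>

text \<open>The explicit formula for \<open>shape_I\<close>, available before \<open>shape_I\<close>
  is known to be well defined.\<close>

definition cot_half_sum :: "real^3 \<Rightarrow> real" where
  "cot_half_sum s = (\<Sum>i\<in>UNIV. cot (s $ i / 2))"

definition double_signed_area :: "triangle \<Rightarrow> real" where
  "double_signed_area P = cross2 (P $ 2 - P $ 1) (P $ 3 - P $ 1)"

text \<open>All three corners see the same signed area. The sign is negative because the edge to the
  previous vertex comes first.\<close>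

lemma cross2_cyclic: "cross2 (P $ (i - 1) - P $ i) (P $ (i + 1) - P $ i) = - double_signed_area P"
proof -
  have "\<forall>i. cross2 (P $ (i - 1) - P $ i) (P $ (i + 1) - P $ i) = - double_signed_area P"
    unfolding forall_3 cyclic3 by (simp add: cross2_def double_signed_area_def algebra_simps)
  then show ?thesis ..
qed

lemma nondegenerate_iff: "nondegenerate P \<longleftrightarrow> double_signed_area P \<noteq> 0"
proof -
  have "cross2 (P $ 1 - P $ 2) (P $ 3 - P $ 2) = - double_signed_area P"
    by (simp add: cross2_def double_signed_area_def algebra_simps)
  then show ?thesis
    by (simp add: nondegenerate_def collinear_iff_cross2)
qed

lemma counterclockwise_iff: "counterclockwise P \<longleftrightarrow> double_signed_area P > 0"
  by (simp add: counterclockwise_def det_2 cross2_def double_signed_area_def)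

lemma area_eq: "area P = \<bar>double_signed_area P\<bar> / 2"
  unfolding area_def content_triangle by (simp add: cross2_def double_signed_area_def algebra_simps abs_minus_commute)

lemma unit_triangles_iff: "P \<in> unit_triangles \<longleftrightarrow> double_signed_area P = 2"
  by (auto simp: unit_triangles_def nondegenerate_iff counterclockwise_iff area_eq)

lemma vertex_angle_triangle:
  fixes P :: triangle and i :: 3
  assumes "nondegenerate P"
  defines "u \<equiv> P $ (i - 1) - P $ i" and "v \<equiv> P $ (i + 1) - P $ i"
  shows "norm u > 0" "norm v > 0" "0 < angles P $ i" "angles P $ i < pi"
    "cos (angles P $ i) = (u \<bullet> v) / (norm u * norm v)"
    "sin (angles P $ i) = \<bar>double_signed_area P\<bar> / (norm u * norm v)"
  using arccos_inner[of u v] assms(1) cross2_cyclic[of P i]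
  by (auto simp: nondegenerate_iff angles_def vertex_angle_def u_def v_def)

text \<open>The law of cosines and the area formula give \<open>cot (\<alpha>/2) = (1 + cos
  \<alpha>) / sin \<alpha> = ((b + c)^2 - a^2) / (2 D)\<close>, where \<open>D\<close> is twice the
  area. The three such terms add up to \<open>(a + b + c)^2 / (2 D)\<close>.\<close>

lemma angles_triangle:
  fixes P :: triangle
  assumes "nondegenerate P"
  shows "angles P \<in> shape_space"
    "(perimeter P)\<^sup>2 / (4 * area P) = cot_half_sum (angles P)"
proof -
  define a b c where "a = norm (P $ 3 - P $ 2)" and "b = norm (P $ 1 - P $ 3)"
    and "c = norm (P $ 2 - P $ 1)"
  define D where "D = \<bar>double_signed_area P\<bar>"
  note v = vertex_angle_triangle[OF assms]
  have D: "D > 0" using assms by (simp add: D_def nondegenerate_iff)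
  have pos: "a > 0" "b > 0" "c > 0"
    using v(2)[of 2] v(2)[of 3] v(2)[of 1] unfolding cyclic3 by (simp_all add: a_def b_def c_def)
  have dot: "u \<bullet> w / (norm u * norm w) = ((norm u)\<^sup>2 + (norm w)\<^sup>2 - (norm (u - w))\<^sup>2) / (2 * norm u * norm w)"
    for u w :: "real^2"
    by (simp add: dot_norm_neg)
  have cs: "cos (angles P $ 1) = (b\<^sup>2 + c\<^sup>2 - a\<^sup>2) / (2 * b * c)"
    "cos (angles P $ 2) = (c\<^sup>2 + a\<^sup>2 - b\<^sup>2) / (2 * c * a)"
    "cos (angles P $ 3) = (a\<^sup>2 + b\<^sup>2 - c\<^sup>2) / (2 * a * b)"
    using v(5)[of 1] v(5)[of 2] v(5)[of 3] unfolding dot cyclic3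
    by (simp_all add: a_def b_def c_def norm_minus_commute)
  have sn: "sin (angles P $ 1) = D / (b * c)" "sin (angles P $ 2) = D / (c * a)"
    "sin (angles P $ 3) = D / (a * b)"
    using v(6)[of 1] v(6)[of 2] v(6)[of 3] unfolding cyclic3
    by (simp_all add: a_def b_def c_def D_def norm_minus_commute)
  have "angles P $ 1 + angles P $ 2 + angles P $ 3 = pi"
    by (rule law_of_cosines_sum[OF pos v(3,4) cs(1) sn(1) v(3,4) cs(2) sn(2) v(3,4) cs(3) sn(3)])
  then show "angles P \<in> shape_space" using v(3) by (simp add: shape_space_def)
  have p: "perimeter P = a + b + c"
    unfolding perimeter_def sum_3 cyclic3 by (simp add: a_def b_def c_def dist_norm norm_minus_commute)
  have "cot_half_sum (angles P) = (1 + (b\<^sup>2 + c\<^sup>2 - a\<^sup>2) / (2 * b * c)) / (D / (b * c))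
     + (1 + (c\<^sup>2 + a\<^sup>2 - b\<^sup>2) / (2 * c * a)) / (D / (c * a))
     + (1 + (a\<^sup>2 + b\<^sup>2 - c\<^sup>2) / (2 * a * b)) / (D / (a * b))"
    using pos D by (simp add: cot_half_sum_def sum_3 cot_half sn cs)
  also have "\<dots> = (a + b + c)\<^sup>2 / (2 * D)"
    using pos D by (simp add: field_simps power2_eq_square)
  finally show "(perimeter P)\<^sup>2 / (4 * area P) = cot_half_sum (angles P)"
    by (simp add: p area_eq D_def)
qed

text \<open>The half angles add up to a right angle; expanding the cosine of their sum and dividing
  by the three sines gives the identity.\<close>

lemma cot_half_sum_eq_prod:
  assumes "s \<in> shape_space"
  shows "cot_half_sum s = cot (s $ 1 / 2) * cot (s $ 2 / 2) * cot (s $ 3 / 2)"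
proof -
  define x y z where "x = s $ 1 / 2" "y = s $ 2 / 2" "z = s $ 3 / 2"
  have sum: "x + y + z = pi / 2" and pos: "x > 0" "y > 0" "z > 0"
    using assms by (auto simp: shape_space_def x_y_z_def field_simps)
  then have "x < pi" "y < pi" "z < pi" by linarith+
  with pos have nz: "sin x \<noteq> 0" "sin y \<noteq> 0" "sin z \<noteq> 0"
    using sin_gt_zero by fastforce+
  have "cos (x + y + z) = 0" by (simp add: sum)
  then have "cos x * cos y * cos z = sin x * sin y * cos z + sin x * cos y * sin z + cos x * sin y * sin z"
    by (simp add: cos_add sin_add algebra_simps)
  then show ?thesis
    using nz by (simp add: cot_half_sum_def sum_3 flip: x_y_z_def) (simp add: cot_def field_simps)
qed

text \<open>Every fibre of \<open>angles\<close> over the shape space is nonempty, so the descended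
  functions are determined on the whole space.\<close>

lemma ex_unit_triangle:
  assumes "s \<in> shape_space"
  obtains P where "P \<in> unit_triangles" "angles P = s"
proof -
  define \<alpha> \<beta> \<gamma> where "\<alpha> = s $ 1" "\<beta> = s $ 2" "\<gamma> = s $ 3"
  have sum: "\<alpha> + \<beta> + \<gamma> = pi" and pos: "\<alpha> > 0" "\<beta> > 0" "\<gamma> > 0"
    using assms by (auto simp: shape_space_def \<alpha>_\<beta>_\<gamma>_def)
  have lt: "\<alpha> < pi" "\<beta> < pi" "\<gamma> < pi" using sum pos by linarith+
  have s: "sin \<alpha> > 0" "sin \<beta> > 0" "sin \<gamma> > 0" using pos lt sin_gt_zero by auto
  have \<gamma>: "\<gamma> = pi - (\<alpha> + \<beta>)" using sum by simp
  have s\<gamma>: "sin \<gamma> = sin \<alpha> * cos \<beta> + cos \<alpha> * sin \<beta>"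
    and c\<gamma>: "cos \<gamma> = sin \<alpha> * sin \<beta> - cos \<alpha> * cos \<beta>"
    unfolding \<gamma> by (simp_all add: sin_diff cos_diff sin_add cos_add)
  \<comment> \<open>The circumdiameter: by the law of sines the sides are \<open>r\<close> times the
    sines, and twice the area is \<open>r^2 * (sin \<alpha> * sin \<beta> * sin \<gamma>)\<close>,
    which has to be 2.\<close>
  define r where "r = sqrt (2 / (sin \<alpha> * sin \<beta> * sin \<gamma>))"
  have r: "r > 0" "r\<^sup>2 * (sin \<alpha> * sin \<beta> * sin \<gamma>) = 2"
    using s by (simp_all add: r_def)
  define P :: triangle where "P = vector [0, vector [r * sin \<gamma>, 0],
     vector [r * sin \<beta> * cos \<alpha>, r * sin \<beta> * sin \<alpha>]]"
  have v1: "P $ 2 - P $ 1 = vector [r * sin \<gamma>, 0]"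
    "P $ 3 - P $ 1 = vector [r * sin \<beta> * cos \<alpha>, r * sin \<beta> * sin \<alpha>]"
    "P $ 3 - P $ 2 = vector [- (r * sin \<alpha> * cos \<beta>), r * sin \<alpha> * sin \<beta>]"
    by (simp_all add: P_def vec_eq_iff forall_2 s\<gamma> algebra_simps)
  have neg: "P $ 1 - P $ 2 = - (P $ 2 - P $ 1)" "P $ 1 - P $ 3 = - (P $ 3 - P $ 1)"
    "P $ 2 - P $ 3 = - (P $ 3 - P $ 2)" by simp_all
  have A: "double_signed_area P = 2"
    using r by (simp add: double_signed_area_def v1 cross2_def algebra_simps power2_eq_square)
  have n: "norm (P $ 2 - P $ 1) = r * sin \<gamma>" "norm (P $ 3 - P $ 1) = r * sin \<beta>"
    "norm (P $ 3 - P $ 2) = r * sin \<alpha>"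
    using r s by (simp_all add: v1 norm_vec_def L2_set_def sum_2 power_mult_distrib real_sqrt_mult flip: distrib_left)
  have d: "(P $ 3 - P $ 1) \<bullet> (P $ 2 - P $ 1) = (r * sin \<beta>) * (r * sin \<gamma>) * cos \<alpha>"
    "(P $ 2 - P $ 1) \<bullet> (P $ 3 - P $ 2) = - ((r * sin \<gamma>) * (r * sin \<alpha>) * cos \<beta>)"
    "(P $ 3 - P $ 2) \<bullet> (P $ 3 - P $ 1) = (r * sin \<alpha>) * (r * sin \<beta>) * cos \<gamma>"
    by (simp_all add: v1 inner_vec_def sum_2 c\<gamma> algebra_simps)
  have "\<forall>i. vertex_angle (P $ (i - 1)) (P $ i) (P $ (i + 1)) = s $ i"
    unfolding forall_3 cyclic3 vertex_angle_def neg norm_minus_cancel n inner_minus_left inner_minus_right d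
    using r s pos lt by (simp add: \<alpha>_\<beta>_\<gamma>_def[symmetric] power2_eq_square arccos_cos)
  then have "angles P = s" by (simp add: angles_def vec_eq_iff)
  with A that show ?thesis by (simp add: unit_triangles_iff)
qed

section \<open>The induced field on the shape space\<close>

lemma cross2_right:
  "cross2 u (x + y) = cross2 u x + cross2 u y" "cross2 u (x - y) = cross2 u x - cross2 u y"
  "cross2 u (k *\<^sub>R x) = k * cross2 u x" "cross2 u u = 0"
  by (simp_all add: cross2_def algebra_simps)

lemma cross2_skew: "cross2 u v = - cross2 v u"
  by (simp add: cross2_def)

text \<open>The Binet-Cauchy identity, in the form that arises when a normalized inner product is
  differentiated.\<close>

lemma cross2_lagrange:
  "(u \<bullet> v) * (u \<bullet> a) - (norm u)\<^sup>2 * (a \<bullet> v) = cross2 v u * cross2 u a"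
  unfolding power2_norm_eq_inner
  by (simp add: cross2_def inner_vec_def sum_2) algebra

text \<open>The positivity hypothesis says that \<open>u\<close> lies counterclockwise of
  \<open>v\<close>. The angle is then the argument of \<open>u\<close> minus that of
  \<open>v\<close>, and the argument of a vector has differential
  \<open>cross2 u du / (norm u)^2\<close>.\<close>

lemma has_derivative_arccos_inner:
  fixes u v :: "'a::real_normed_vector \<Rightarrow> real^2"
  assumes u: "(u has_derivative u') (at p)" and v: "(v has_derivative v') (at p)"
    and pos: "cross2 (v p) (u p) > 0"
  shows "((\<lambda>x. arccos (u x \<bullet> v x / (norm (u x) * norm (v x)))) has_derivative
    (\<lambda>h. cross2 (u p) (u' h) / (norm (u p))\<^sup>2 - cross2 (v p) (v' h) / (norm (v p))\<^sup>2)) (at p)"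
proof -
  define q D n m where "q = u p \<bullet> v p / (norm (u p) * norm (v p))"
    and "D = cross2 (v p) (u p)" and "n = norm (u p)" and "m = norm (v p)"
  have D: "cross2 (u p) (v p) = - D" by (simp add: D_def cross2_def)
  then have nz: "cross2 (u p) (v p) \<noteq> 0" using pos D_def by simp
  note ai = arccos_inner[OF nz, folded q_def n_def m_def]
  have n: "((\<lambda>x. norm (u x)) has_derivative (\<lambda>h. u p \<bullet> u' h / n)) (at p)"
    and m: "((\<lambda>x. norm (v x)) has_derivative (\<lambda>h. v p \<bullet> v' h / m)) (at p)"
    using has_derivative_compose[OF u has_derivative_norm[of "u p"]]
      has_derivative_compose[OF v has_derivative_norm[of "v p"]] ai(1,2)
    by (auto simp: sgn_div_norm n_def m_def inner_commute divide_inverse mult.commute)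
  have 1: "((\<lambda>x. u x \<bullet> v x / (norm (u x) * norm (v x))) has_derivative
     (\<lambda>h. ((u p \<bullet> v' h + u' h \<bullet> v p) * (n * m)
        - (u p \<bullet> v p) * (n * (v p \<bullet> v' h / m) + (u p \<bullet> u' h / n) * m)) / (n * m)\<^sup>2)) (at p)"
    by (rule has_derivative_eq_rhs[OF has_derivative_divide'[OF has_derivative_inner[OF u v] has_derivative_mult[OF n m]]])
      (use ai(1,2) in \<open>auto simp: n_def m_def power2_eq_square\<close>)
  have sq: "sqrt (1 - q\<^sup>2) = D / (n * m)"
    using ai(3,4,8) pos by (simp add: sin_arccos D D_def[symmetric])
  \<comment> \<open>The first factor is the derivative of \<open>arccos\<close> at \<open>q\<close>.
    By \<open>cross2_lagrange\<close>, used once for each vector, \<open>D\<close> splits off from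
    both summands and cancels.\<close>
  have 2: "- inverse (D / (n * m)) * (((u p \<bullet> v' h + u' h \<bullet> v p) * (n * m)
        - (u p \<bullet> v p) * (n * (v p \<bullet> v' h / m) + (u p \<bullet> u' h / n) * m)) / (n * m)\<^sup>2)
      = cross2 (u p) (u' h) / n\<^sup>2 - cross2 (v p) (v' h) / m\<^sup>2" (is "?l = ?r") for h
  proof -
    have "?l = (((u p \<bullet> v p) * (u p \<bullet> u' h) - n\<^sup>2 * (u' h \<bullet> v p)) / n\<^sup>2
       + ((v p \<bullet> u p) * (v p \<bullet> v' h) - m\<^sup>2 * (v' h \<bullet> u p)) / m\<^sup>2) / D"
      using ai(1,2) pos unfolding D_def[symmetric]
      by (simp add: inner_commute divide_simps) (simp add: algebra_simps power2_eq_square)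
    also have "\<dots> = (D * cross2 (u p) (u' h) / n\<^sup>2 + (- D) * cross2 (v p) (v' h) / m\<^sup>2) / D"
      unfolding n_def m_def cross2_lagrange D D_def[symmetric] ..
    also have "\<dots> = ?r"
      using ai(1,2) pos unfolding D_def[symmetric] by (simp add: field_simps)
    finally show ?thesis .
  qed
  show ?thesis
    using has_derivative_arccos[OF ai(3,4)[unfolded q_def n_def m_def] 1]
    unfolding q_def[symmetric] sq
    by (rule has_derivative_eq_rhs) (use 2 in \<open>auto simp: n_def m_def mult.commute\<close>)
qed

text \<open>The differential of \<open>angles\<close> at \<open>P\<close> in direction
  \<open>H\<close>: at each vertex, the rotation rate of the edge to the previous vertex minus that
  of the edge to the next one.\<close>

definition angle_velocity :: "triangle \<Rightarrow> triangle \<Rightarrow> real^3" where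
  "angle_velocity P H = (\<chi> i.
     cross2 (P $ (i - 1) - P $ i) (H $ (i - 1) - H $ i) / (norm (P $ (i - 1) - P $ i))\<^sup>2 -
     cross2 (P $ (i + 1) - P $ i) (H $ (i + 1) - H $ i) / (norm (P $ (i + 1) - P $ i))\<^sup>2)"

lemma angles_has_derivative:
  assumes "counterclockwise P"
  shows "(angles has_derivative angle_velocity P) (at P)"
proof -
  have nth: "((\<lambda>Q::triangle. Q $ j - Q $ i) has_derivative (\<lambda>H. H $ j - H $ i)) (at P)" for i j
    by (intro has_derivative_diff bounded_linear_imp_has_derivative bounded_linear_vec_nth)
  have 1: "((\<lambda>Q. angles Q $ i) has_derivative (\<lambda>H. angle_velocity P H $ i)) (at P)" for i
  proof -
    have "cross2 (P $ (i + 1) - P $ i) (P $ (i - 1) - P $ i) > 0"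
      using cross2_cyclic[of P i] assms by (simp add: cross2_def counterclockwise_iff mult.commute)
    from has_derivative_arccos_inner[OF nth nth this]
    show ?thesis by (simp add: angles_def vertex_angle_def angle_velocity_def)
  qed
  show ?thesis
    by (subst has_derivative_componentwise_within) (auto simp: Basis_vec_def inner_axis intro: 1)
qed

text \<open>The induced field without its positive scalar factor
  \<open>sqrt (cot_half_sum s) / 2\<close>. Being polynomial in sines, it is globally Lipschitz on
  the whole space.\<close>

definition shape_dir :: "real^3 \<Rightarrow> real^3" where
  "shape_dir s = (\<chi> i. sin (s $ i) * (sin (s $ (i - 1)) - sin (s $ (i + 1))))"

text \<open>For unit area the cross product of any two edges is 2 up to sign, so the rotation rates
  of the edges depend on the side lengths alone. The sines are 2 over products of two sides, and the
  root of the integral is half the perimeter.\<close>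

lemma angle_velocity_xi:
  assumes "P \<in> unit_triangles"
  shows "angle_velocity P (xi P) = (sqrt (cot_half_sum (angles P)) / 2) *\<^sub>R shape_dir (angles P)"
proof -
  have A: "double_signed_area P = 2" and nd: "nondegenerate P"
    using assms by (simp_all add: unit_triangles_iff nondegenerate_iff)
  have cc: "i - 1 - 1 = i + 1" "i + 1 + 1 = i - 1" "i - 1 + 1 = i" "i + 1 - 1 = i" for i :: 3
  proof -
    have "\<forall>i::3. i - 1 - 1 = i + 1 \<and> i + 1 + 1 = i - 1" by (simp add: forall_3)
    then show "i - 1 - 1 = i + 1" "i + 1 + 1 = i - 1" "i - 1 + 1 = i" "i + 1 - 1 = i" by simp_all
  qed
  have per: "perimeter P = norm (P $ (i - 1) - P $ i) + norm (P $ (i + 1) - P $ i)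
      + norm (P $ (i - 1) - P $ (i + 1))" for i
  proof -
    have "\<forall>i. perimeter P = norm (P $ (i - 1) - P $ i) + norm (P $ (i + 1) - P $ i)
      + norm (P $ (i - 1) - P $ (i + 1))"
      unfolding perimeter_def sum_3 forall_3 cyclic3 by (simp add: dist_norm norm_minus_commute)
    then show ?thesis ..
  qed
  have "perimeter P \<ge> 0" by (simp add: perimeter_def sum_nonneg)
  then have rt: "sqrt (cot_half_sum (angles P)) = perimeter P / 2"
    unfolding angles_triangle(2)[OF nd, symmetric]
    by (simp add: area_eq A real_sqrt_divide)
  have "angle_velocity P (xi P) $ i =
     perimeter P / 4 * (sin (angles P $ i) * (sin (angles P $ (i - 1)) - sin (angles P $ (i + 1))))" for i
  proof -
    define u v w where "u = P $ (i - 1) - P $ i" and "v = P $ (i + 1) - P $ i" and "w = u - v"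
    have w: "P $ (i - 1) - P $ (i + 1) = w" by (simp add: w_def u_def v_def)
    have neg: "P $ i - P $ (i - 1) = - u" "P $ i - P $ (i + 1) = - v" "P $ (i + 1) - P $ (i - 1) = - w"
      by (simp_all add: w_def u_def v_def)
    have x: "xi P $ i = (1/2) *\<^sub>R ((- u) /\<^sub>R norm u - (- v) /\<^sub>R norm v)"
      "xi P $ (i + 1) = (1/2) *\<^sub>R (v /\<^sub>R norm v - (- w) /\<^sub>R norm w)"
      "xi P $ (i - 1) = (1/2) *\<^sub>R (w /\<^sub>R norm w - u /\<^sub>R norm u)"
      by (simp_all only: xi_def vec_lambda_beta cc neg w norm_minus_cancel flip: u_def v_def)
    have pos: "norm u > 0" "norm v > 0" "norm w > 0"
      using vertex_angle_triangle(1,2)[OF nd, of i] vertex_angle_triangle(2)[OF nd, of "i + 1"]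
      unfolding cc by (simp_all add: w_def u_def v_def)
    have sn: "sin (angles P $ i) = 2 / (norm u * norm v)"
      "sin (angles P $ (i + 1)) = 2 / (norm v * norm w)"
      "sin (angles P $ (i - 1)) = 2 / (norm w * norm u)"
      using vertex_angle_triangle(6)[OF nd, of i] vertex_angle_triangle(6)[OF nd, of "i + 1"]
        vertex_angle_triangle(6)[OF nd, of "i - 1"]
      unfolding cc neg w A by (simp_all flip: u_def v_def)
    have cuv: "cross2 u v = - 2"
      using cross2_cyclic[of P i] A by (simp flip: u_def v_def)
    \<comment> \<open>The unit vector along an edge cancels from the relative velocity of its two
      endpoints.\<close>
    have dx: "xi P $ (i - 1) - xi P $ i = (1/2) *\<^sub>R (w /\<^sub>R norm w - v /\<^sub>R norm v)"
      "xi P $ (i + 1) - xi P $ i = (1/2) *\<^sub>R (w /\<^sub>R norm w + u /\<^sub>R norm u)"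
      unfolding x by (simp_all add: algebra_simps)
    have c: "cross2 u (xi P $ (i - 1) - xi P $ i) = 1 / norm w + 1 / norm v"
      "cross2 v (xi P $ (i + 1) - xi P $ i) = 1 / norm w + 1 / norm u"
    proof -
      have "cross2 v u = 2" using cuv by (simp add: cross2_skew[of v u])
      then have "cross2 u w = 2" "cross2 v w = 2" "cross2 v u = 2"
        using cuv by (simp_all add: w_def cross2_right)
      then show "cross2 u (xi P $ (i - 1) - xi P $ i) = 1 / norm w + 1 / norm v"
        "cross2 v (xi P $ (i + 1) - xi P $ i) = 1 / norm w + 1 / norm u"
        unfolding dx by (simp_all add: cross2_right cuv field_simps)
    qed
    have "angle_velocity P (xi P) $ i = (1 / norm w + 1 / norm v) / (norm u)\<^sup>2 - (1 / norm w + 1 / norm u) / (norm v)\<^sup>2"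
      unfolding angle_velocity_def by (simp add: c flip: u_def v_def)
    also have "\<dots> = (norm u + norm v + norm w) / 4 * (2 / (norm u * norm v) * (2 / (norm w * norm u) - 2 / (norm v * norm w)))"
      using pos by (simp add: divide_simps) (simp add: algebra_simps power2_eq_square)
    finally show ?thesis unfolding sn per[of i] w by (simp flip: u_def v_def)
  qed
  then show ?thesis by (simp add: rt shape_dir_def vec_eq_iff)
qed

section \<open>Descending to the shape space\<close>

text \<open>The triangle \<open>P\<close> makes the fibre nonempty and the factorization through
  \<open>angles\<close> makes \<open>F\<close> constant on it, so \<open>the_elem\<close> is applied
  to a singleton.\<close>

lemma descend_eq:
  assumes "P \<in> T" "\<And>Q. Q \<in> T \<Longrightarrow> F Q = f (angles Q)"
  shows "descend T F (angles P) = f (angles P)"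
proof -
  have "F ` {Q \<in> T. angles Q = angles P} = {f (angles P)}"
    using assms by auto
  then show ?thesis by (simp add: descend_def)
qed

lemma shape_field_angles:
  assumes "P \<in> unit_triangles"
  shows "angles differentiable (at P)"
    "frechet_derivative angles (at P) (xi P) = (sqrt (cot_half_sum (angles P)) / 2) *\<^sub>R shape_dir (angles P)"
    "shape_field (angles P) = (sqrt (cot_half_sum (angles P)) / 2) *\<^sub>R shape_dir (angles P)"
proof -
  have d: "(angles has_derivative angle_velocity Q) (at Q)" if "Q \<in> unit_triangles" for Q
    using that angles_has_derivative by (simp add: unit_triangles_def)
  then show "angles differentiable (at P)" using assms differentiableI by blast
  have f: "frechet_derivative angles (at Q) (xi Q) = (sqrt (cot_half_sum (angles Q)) / 2) *\<^sub>R shape_dir (angles Q)"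
    if "Q \<in> unit_triangles" for Q
    using frechet_derivative_at[OF d[OF that]] angle_velocity_xi[OF that] by simp
  show "frechet_derivative angles (at P) (xi P) = (sqrt (cot_half_sum (angles P)) / 2) *\<^sub>R shape_dir (angles P)"
    by (rule f[OF assms])
  show "shape_field (angles P) = (sqrt (cot_half_sum (angles P)) / 2) *\<^sub>R shape_dir (angles P)"
    unfolding shape_field_def
    by (rule descend_eq[where f="\<lambda>s. (sqrt (cot_half_sum s) / 2) *\<^sub>R shape_dir s"]) (use assms f in auto)
qed

lemma shape_field_eq:
  assumes "s \<in> shape_space"
  shows "shape_field s = (sqrt (cot_half_sum s) / 2) *\<^sub>R shape_dir s"
  using ex_unit_triangle[OF assms] shape_field_angles(3) by metis

lemma shape_I_angles:
  assumes "nondegenerate P"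
  shows "shape_I (angles P) = cot_half_sum (angles P)"
  unfolding shape_I_def by (rule descend_eq) (use assms angles_triangle(2) in auto)

lemma shape_I_eq:
  assumes "s \<in> shape_space"
  shows "shape_I s = cot_half_sum s"
  using ex_unit_triangle[OF assms] shape_I_angles unit_triangles_def by (metis (mono_tags, lifting) mem_Collect_eq)

section \<open>Scalar and Lipschitz differential equations\<close>

text \<open>Gronwall's argument for the squared distance \<open>e\<close>: since
  \<open>\<bar>e'\<bar> \<le> 2 * L * e\<close>, a suitable exponential weight makes
  \<open>e\<close> nonincreasing to the right of \<open>t0\<close> and nondecreasing to the left,
  and \<open>e\<close> vanishes at \<open>t0\<close>.\<close>

lemma lipschitz_ode_unique:
  fixes F :: "'a::real_inner \<Rightarrow> 'a" and c d :: "real \<Rightarrow> 'a"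
  assumes J: "is_interval J" and lip: "\<And>x y. norm (F x - F y) \<le> L * norm (x - y)"
    and c: "\<And>t. t \<in> J \<Longrightarrow> (c has_vector_derivative F (c t)) (at t)"
    and d: "\<And>t. t \<in> J \<Longrightarrow> (d has_vector_derivative F (d t)) (at t)"
    and t0: "t0 \<in> J" "c t0 = d t0" and t: "t \<in> J"
  shows "c t = d t"
proof -
  define e where "e s = (c s - d s) \<bullet> (c s - d s)" for s
  define e' where "e' s = 2 * ((c s - d s) \<bullet> (F (c s) - F (d s)))" for s
  have e: "(e has_real_derivative e' s) (at s)" if "s \<in> J" for s
  proof -
    have "((\<lambda>s. c s - d s) has_derivative (\<lambda>h. h *\<^sub>R (F (c s) - F (d s)))) (at s)"
      using has_vector_derivative_diff[OF c d, OF that that] by (simp add: has_vector_derivative_def)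
    from has_derivative_inner[OF this this]
    show ?thesis
      unfolding has_field_derivative_def e_def[abs_def]
      by (rule has_derivative_eq_rhs) (simp add: e'_def inner_commute fun_eq_iff)
  qed
  have bound: "\<bar>e' s\<bar> \<le> 2 * L * e s" for s
  proof -
    have "\<bar>e' s\<bar> \<le> 2 * (norm (c s - d s) * norm (F (c s) - F (d s)))"
      using Cauchy_Schwarz_ineq2[of "c s - d s"] by (simp add: e'_def abs_mult)
    also have "\<dots> \<le> 2 * (norm (c s - d s) * (L * norm (c s - d s)))"
      by (intro mult_left_mono lip) auto
    also have "\<dots> = 2 * L * e s"
      by (simp add: e_def power2_norm_eq_inner[symmetric] power2_eq_square)
    finally show ?thesis .
  qed
  have e0: "e t0 = 0" using t0 by (simp add: e_def)
  have "e t \<le> 0"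
  proof (cases "t0 \<le> t")
    case True
    have "e t * exp (- (2 * L * t)) \<le> e t0 * exp (- (2 * L * t0))"
    proof (rule DERIV_nonpos_imp_nonincreasing[OF True])
      fix s assume "t0 \<le> s" "s \<le> t"
      then have "s \<in> J" using J t0 t by (meson is_interval_1)
      then have "((\<lambda>s. e s * exp (- (2 * L * s))) has_real_derivative
          (e' s - 2 * L * e s) * exp (- (2 * L * s))) (at s)"
        by (auto intro!: derivative_eq_intros e simp: algebra_simps)
      moreover have "(e' s - 2 * L * e s) * exp (- (2 * L * s)) \<le> 0"
        using bound[of s] by (simp add: mult_nonpos_nonneg)
      ultimately show "\<exists>y. ((\<lambda>s. e s * exp (- (2 * L * s))) has_real_derivative y) (at s) \<and> y \<le> 0"
        by blast
    qed
    then show ?thesis by (simp add: e0 mult_le_0_iff)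
  next
    case False
    then have "t \<le> t0" by simp
    then have "e t * exp (2 * L * t) \<le> e t0 * exp (2 * L * t0)"
    proof (rule DERIV_nonneg_imp_nondecreasing)
      fix s assume "t \<le> s" "s \<le> t0"
      then have "s \<in> J" using J t0 t by (meson is_interval_1)
      then have "((\<lambda>s. e s * exp (2 * L * s)) has_real_derivative
          (e' s + 2 * L * e s) * exp (2 * L * s)) (at s)"
        by (auto intro!: derivative_eq_intros e simp: algebra_simps)
      moreover have "(e' s + 2 * L * e s) * exp (2 * L * s) \<ge> 0"
        using bound[of s] by (simp add: mult_nonpos_nonneg)
      ultimately show "\<exists>y. ((\<lambda>s. e s * exp (2 * L * s)) has_real_derivative y) (at s) \<and> y \<ge> 0"
        by blast
    qed
    then show ?thesis by (simp add: e0 mult_le_0_iff)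
  qed
  then show ?thesis unfolding e_def by (metis eq_iff inner_eq_zero_iff inner_ge_zero right_minus_eq)
qed

text \<open>Separation of variables: an antiderivative \<open>H\<close> of \<open>1 / g\<close>
  measures the time needed to reach a position, and its inverse is the solution. Periodicity of
  \<open>g\<close> turns a shift of the position by \<open>p\<close> into a shift of the time by a
  constant \<open>T\<close>.\<close>

lemma periodic_autonomous_ode:
  fixes g :: "real \<Rightarrow> real"
  assumes cont: "\<And>x. isCont g x" and pos: "\<And>x. g x > 0"
    and p: "p > 0" and per: "\<And>x. g (x + p) = g x"
  obtains \<Phi> T where "T > 0" "\<Phi> 0 = a" "\<And>t. \<Phi> (t + T) = \<Phi> t + p"
    "\<And>t. (\<Phi> has_real_derivative g (\<Phi> t)) (at t)"
proof -
  have "isCont (\<lambda>x. 1 / g x) x" for x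
    using cont[of x] pos[of x] by (intro continuous_intros) auto
  then obtain H0 where "\<forall>x. (H0 has_vector_derivative 1 / g x) (at x)"
    using einterval_antiderivative[of "-\<infinity>" "\<infinity>" "\<lambda>x. 1 / g x"] by auto
  then have H0: "(H0 has_real_derivative 1 / g x) (at x)" for x
    by (simp add: has_real_derivative_iff_has_vector_derivative)
  define H where "H x = H0 x - H0 a" for x
  have H: "(H has_real_derivative 1 / g x) (at x)" for x
    unfolding H_def[abs_def] by (auto intro!: derivative_eq_intros H0)
  have mono: "H x < H y" if "x < y" for x y
    using that by (rule DERIV_pos_imp_increasing) (use H pos in \<open>auto intro!: exI\<close>)
  define T where "T = H (a + p)"
  have T: "T > 0" using mono[of a "a + p"] p by (simp add: T_def H_def)
  have shift: "H (x + p) = H x + T" for x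
  proof -
    have "((\<lambda>x. H (x + p) - H x) has_real_derivative 0) (at x)" for x
    proof -
      have "((\<lambda>x. H (x + p)) has_real_derivative 1 / g (x + p)) (at x)"
        using H[of "x + p"] by (simp add: DERIV_shift)
      from DERIV_diff[OF this H] show ?thesis by (simp add: per)
    qed
    then have "H (x + p) - H x = H (a + p) - H a"
      using DERIV_isconst_all by blast
    then show ?thesis by (simp add: T_def H_def)
  qed
  have shiftn: "H (x + of_nat n * p) = H x + of_nat n * T" for x n
  proof (induction n)
    case (Suc n)
    have "H (x + of_nat (Suc n) * p) = H (x + of_nat n * p + p)" by (simp add: algebra_simps)
    then show ?case using Suc shift[of "x + of_nat n * p"] by (simp add: algebra_simps)
  qed simp
  \<comment> \<open>Iterated shifts make \<open>H\<close> unbounded in both directions, so the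
    intermediate value theorem gives surjectivity and the solution exists for all times.\<close>
  have "\<exists>x. H x = y" for y
  proof -
    obtain n where "\<bar>y\<bar> < of_nat n * T" using T reals_Archimedean3 by blast
    then have n: "H (a - of_nat n * p) \<le> y" "y \<le> H (a + of_nat n * p)"
      using shiftn[of a n] shiftn[of "a - of_nat n * p" n] by (auto simp: H_def)
    have "a - of_nat n * p \<le> a + of_nat n * p" using p by simp
    from IVT[OF n this] show ?thesis using DERIV_isCont[OF H] by blast
  qed
  then obtain \<Phi> where \<Phi>: "H (\<Phi> y) = y" for y by metis
  have inj: "x = y" if "H x = H y" for x y
    using mono[of x y] mono[of y x] that by (cases x y rule: linorder_cases) auto
  show ?thesis
  proof
    show "T > 0" by fact
    show "\<Phi> 0 = a" by (rule inj) (simp add: \<Phi>, simp add: H_def)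
    show "\<Phi> (t + T) = \<Phi> t + p" for t by (rule inj) (simp add: \<Phi> shift)
    show "(\<Phi> has_real_derivative g (\<Phi> t)) (at t)" for t
    proof -
      have "isCont \<Phi> (H (\<Phi> t))"
        by (rule isCont_inverse_function[where d=1]) (auto intro: inj DERIV_isCont H simp: \<Phi>)
      then have "isCont \<Phi> t" by (simp add: \<Phi>)
      have "(\<Phi> has_real_derivative inverse (1 / g (\<Phi> t))) (at t)"
        by (rule DERIV_inverse_function[where f=H and a="t-1" and b="t+1"])
          (use \<open>isCont \<Phi> t\<close> pos[of "\<Phi> t"] in \<open>auto simp: \<Phi> H\<close>)
      then show ?thesis by simp
    qed
  qed
qed

section \<open>Closed level curves\<close>

text \<open>If \<open>x + y + z = x * y * z = h\<close>, then
  \<open>x * (y - z)^2 = x * (h - x)^2 - 4 * h\<close>. The roots of this cubic are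
  \<open>m - \<rho>\<close>, \<open>m + \<rho>\<close> and \<open>r\<close>; the first two bound the
  range of \<open>x\<close> on the oval. For \<open>h > 0\<close> the cubic is positive at
  \<open>h / 3\<close> exactly when \<open>h^2 > 27\<close>.\<close>

lemma cubic_roots:
  fixes h :: real
  assumes h: "h > 0" "h\<^sup>2 > 27"
  obtains m \<rho> r where "0 < \<rho>" "\<rho> < m" "m + \<rho> < h" "h < r"
    "2 * m + r = 2 * h" "m\<^sup>2 - \<rho>\<^sup>2 + 2 * m * r = h\<^sup>2" "(m\<^sup>2 - \<rho>\<^sup>2) * r = 4 * h"
proof -
  define f where "f x = x * (h - x)\<^sup>2 - 4 * h" for x
  have cont: "isCont f x" for x unfolding f_def[abs_def] by (intro continuous_intros)
  have neg: "f 0 < 0" "f h < 0" using h by (auto simp: f_def)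
  have "f (h/3) = 4 * h * (h\<^sup>2 - 27) / 27" by (simp add: f_def power2_eq_square field_simps)
  moreover have "4 * h * (h\<^sup>2 - 27) / 27 > 0" using h by simp
  ultimately have pos: "f (h/3) > 0" by (simp only:)
  obtain a where a: "0 \<le> a" "a \<le> h/3" "f a = 0"
    using IVT[of f 0 0 "h/3"] neg pos h cont by auto
  obtain b where b: "h/3 \<le> b" "b \<le> h" "f b = 0"
    using IVT2[of f h 0 "h/3"] neg pos h cont by auto
  have ab: "0 < a" "a < b" "b < h"
    using a b neg pos by (auto simp: order.strict_iff_order)
  \<comment> \<open>The third root is prescribed by the sum \<open>2 * h\<close> of all roots. The
    cubic and its intended factorization then differ by an affine function, with slope
    \<open>e\<close>, that vanishes at the distinct points \<open>a\<close> and
    \<open>b\<close>.\<close>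
  define r e where "r = 2 * h - a - b" and "e = h\<^sup>2 - (a * b + a * r + b * r)"
  have dif: "f x - (x - a) * (x - b) * (x - r) = e * x + (a * b * r - 4 * h)" for x
    unfolding f_def e_def r_def by algebra
  have "e * a + (a * b * r - 4 * h) = 0" "e * b + (a * b * r - 4 * h) = 0"
    using dif[of a] dif[of b] a b by simp_all
  then have "e * (b - a) = 0" by algebra
  then have e: "e = 0" using ab by simp
  then have 3: "a * b * r = 4 * h" using dif[of a] a by simp
  \<comment> \<open>The cubic is negative at \<open>h\<close> while the factors of \<open>a\<close>
    and \<open>b\<close> are positive there, so the third root lies beyond \<open>h\<close>.\<close>
  have "f h = (h - a) * (h - b) * (h - r)" using dif[of h] 3 e by simp
  then have "r > h" using neg ab by (smt (verit) mult_nonneg_nonneg)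
  show ?thesis
  proof (rule that[of "(b - a) / 2" "(a + b) / 2" r])
    show "2 * ((a + b) / 2) + r = 2 * h" by (simp add: r_def field_simps)
    have ab2: "((a + b) / 2)\<^sup>2 - ((b - a) / 2)\<^sup>2 = a * b" by (simp add: power2_eq_square field_simps)
    then show "((a + b) / 2)\<^sup>2 - ((b - a) / 2)\<^sup>2 + 2 * ((a + b) / 2) * r = h\<^sup>2"
      using e by (simp add: e_def algebra_simps)
    show "(((a + b) / 2)\<^sup>2 - ((b - a) / 2)\<^sup>2) * r = 4 * h" unfolding ab2 by (rule 3)
  qed (use ab \<open>r > h\<close> in \<open>auto simp: field_simps\<close>)
qed

text \<open>\<open>X\<close> stands for one half-angle cotangent and \<open>D\<close> for the
  difference of the other two, whose sum is \<open>h - X\<close> and whose product is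
  \<open>h / X\<close>. The two differential equations express the induced field in these
  coordinates.\<close>

lemma level_curve_solution:
  fixes h x d :: real
  assumes h: "h > 0" "h\<^sup>2 > 27" and x: "0 < x" "x < h" and d: "d\<^sup>2 = (h - x)\<^sup>2 - 4 * h / x"
  obtains X D T where "T > 0" "\<And>t. X (t + T) = X t" "\<And>t. D (t + T) = D t" "X 0 = x" "D 0 = d"
    "\<And>t. 0 < X t" "\<And>t. X t < h" "\<And>t. (D t)\<^sup>2 = (h - X t)\<^sup>2 - 4 * h / X t"
    "\<And>t. (X has_real_derivative - (sqrt h * (X t)\<^sup>2 * D t / ((h - X t) * (1 + (X t)\<^sup>2)))) (at t)"
    "\<And>t. (D has_real_derivative sqrt h * ((X t)\<^sup>2 * (h - X t) - 2 * h) / ((h - X t) * (1 + (X t)\<^sup>2))) (at t)"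
proof -
  obtain m \<rho> r where r: "0 < \<rho>" "\<rho> < m" "m + \<rho> < h" "h < r"
    "2 * m + r = 2 * h" "m\<^sup>2 - \<rho>\<^sup>2 + 2 * m * r = h\<^sup>2" "(m\<^sup>2 - \<rho>\<^sup>2) * r = 4 * h"
    using cubic_roots[OF h] by metis
  \<comment> \<open>With \<open>d = y - z\<close> the level curve is \<open>x d\<^sup>2 = (x - (m - \<rho>)) (m + \<rho> - x) (r - x)\<close>. The substitution
    \<open>x = m - \<rho> cos \<phi>\<close> turns the first two factors into \<open>(\<rho> sin \<phi>)\<^sup>2\<close>, so the square root becomes
    smooth in \<open>\<phi>\<close> also at the two turning points of \<open>x\<close>.\<close>
  define W where "W x = sqrt ((r - x) / x)" for x
  define \<xi> where "\<xi> \<phi> = m - \<rho> * cos \<phi>" for \<phi>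
  define \<delta> where "\<delta> \<phi> = - \<rho> * sin \<phi> * W (\<xi> \<phi>)" for \<phi>
  \<comment> \<open>Chosen so that \<open>\<rho> * sin \<phi> * g \<phi>\<close> is the prescribed
    velocity of \<open>X\<close>. The factor \<open>sin \<phi>\<close> of \<open>\<delta>\<close>
    has cancelled, so \<open>g\<close> stays positive at the turning points.\<close>
  define g where "g \<phi> = sqrt h * (\<xi> \<phi>)\<^sup>2 * W (\<xi> \<phi>) / ((h - \<xi> \<phi>) * (1 + (\<xi> \<phi>)\<^sup>2))" for \<phi>
  have \<xi>: "0 < \<xi> \<phi>" "\<xi> \<phi> < h" for \<phi>
  proof -
    have "\<bar>\<rho> * cos \<phi>\<bar> \<le> \<rho>" using r(1) abs_cos_le_one[of \<phi>] by (simp add: abs_mult mult_left_le)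
    then show "0 < \<xi> \<phi>" "\<xi> \<phi> < h" using r unfolding \<xi>_def by linarith+
  qed
  have W: "W x > 0" "(W x)\<^sup>2 = (r - x) / x" if "0 < x" "x < h" for x
    using that r by (auto simp: W_def)
  have nz: "1 + (\<xi> \<phi>)\<^sup>2 \<noteq> 0" for \<phi> by (smt (verit) zero_le_power2)
  have g: "isCont g \<phi>" "g \<phi> > 0" "g (\<phi> + 2 * pi) = g \<phi>" for \<phi>
  proof -
    show "isCont g \<phi>" unfolding g_def[abs_def] W_def \<xi>_def
      using \<xi>[of \<phi>] nz[of \<phi>] unfolding \<xi>_def by (intro continuous_intros) auto
    show "g \<phi> > 0" using \<xi>[of \<phi>] W[OF \<xi>, of \<phi>] h unfolding g_def
      by (intro divide_pos_pos mult_pos_pos add_pos_nonneg) auto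
    show "g (\<phi> + 2 * pi) = g \<phi>" by (simp add: g_def \<xi>_def)
  qed
  \<comment> \<open>The second identity is the factorization of the cubic. The first equates, up to
    the factor \<open>x^2\<close>, the derivatives in \<open>x\<close> of the two resulting
    expressions for \<open>d^2\<close>.\<close>
  have key: "2 * (m - x) * x * (r - x) - (\<rho>\<^sup>2 - (m - x)\<^sup>2) * r = 4 * h - 2 * (h - x) * x\<^sup>2"
    "(\<rho>\<^sup>2 - (m - x)\<^sup>2) * (r - x) = x * (h - x)\<^sup>2 - 4 * h" for x
    using r(5-7) by algebra+
  obtain a where a: "\<xi> a = x" "\<delta> a = d"
  proof -
    have "(d / W x)\<^sup>2 = \<rho>\<^sup>2 - (m - x)\<^sup>2"
    proof -
      have "d\<^sup>2 * x = (\<rho>\<^sup>2 - (m - x)\<^sup>2) * (r - x)"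
        unfolding key d using x by (simp add: field_simps)
      then show ?thesis unfolding power_divide W(2)[OF x] using x r by (simp add: field_simps)
    qed
    \<comment> \<open>This point of the unit circle supplies the initial phase; its second
      coordinate records the sign of \<open>d\<close>.\<close>
    then have "((m - x) / \<rho>)\<^sup>2 + (- (d / W x) / \<rho>)\<^sup>2 = 1"
      using r by (simp add: power_divide field_simps)
    then obtain a where a: "(m - x) / \<rho> = cos a" "- (d / W x) / \<rho> = sin a"
      using sincos_total_2pi by metis
    then have "m - x = \<rho> * cos a" "d / W x = - \<rho> * sin a"
      unfolding a[symmetric] using r by simp_all
    then have "\<xi> a = x" "\<delta> a = d" using W(1)[OF x] by (auto simp: \<xi>_def \<delta>_def field_simps)
    then show ?thesis by (rule that)
  qed
  have "2 * pi > 0" by simp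
  then obtain \<Phi> T where \<Phi>: "T > 0" "\<Phi> 0 = a" "\<And>t. \<Phi> (t + T) = \<Phi> t + 2 * pi"
    "\<And>t. (\<Phi> has_real_derivative g (\<Phi> t)) (at t)"
    using periodic_autonomous_ode[OF g(1) g(2) _ g(3), of a] by blast
  have sc: "(\<rho> * sin \<phi>)\<^sup>2 = \<rho>\<^sup>2 - (m - \<xi> \<phi>)\<^sup>2" "\<rho> * cos \<phi> = m - \<xi> \<phi>" for \<phi>
    by (simp_all add: \<xi>_def power_mult_distrib sin_squared_eq algebra_simps)
  have \<delta>: "(\<delta> \<phi>)\<^sup>2 = (h - \<xi> \<phi>)\<^sup>2 - 4 * h / \<xi> \<phi>" for \<phi>
  proof -
    have "(\<delta> \<phi>)\<^sup>2 = (\<rho>\<^sup>2 - (m - \<xi> \<phi>)\<^sup>2) * (r - \<xi> \<phi>) / \<xi> \<phi>"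
      using sc(1)[of \<phi>] W(2)[OF \<xi>, of \<phi>] by (simp add: \<delta>_def power_mult_distrib)
    then show ?thesis unfolding key using \<xi>[of \<phi>] by (simp add: field_simps)
  qed
  have d\<xi>: "((\<lambda>t. \<xi> (\<Phi> t)) has_real_derivative \<rho> * sin (\<Phi> t) * g (\<Phi> t)) (at t)" for t
    unfolding \<xi>_def by (auto intro!: derivative_eq_intros \<Phi>(4))
  have dW: "(W has_real_derivative - r / (2 * x\<^sup>2 * W x)) (at x)" if "0 < x" "x < h" for x
  proof -
    have q: "(r - x) / x > 0" using that r by simp
    have "((\<lambda>x. (r - x) / x) has_real_derivative - r / x\<^sup>2) (at x)"
      using that by (auto intro!: derivative_eq_intros simp: field_simps power2_eq_square)
    from DERIV_chain2[OF DERIV_real_sqrt[OF q] this] show ?thesis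
      unfolding W_def[abs_def] by (simp add: field_simps)
  qed
  show ?thesis
  proof (rule that[of T "\<lambda>t. \<xi> (\<Phi> t)" "\<lambda>t. \<delta> (\<Phi> t)"])
    fix t
    define w X where "w = W (\<xi> (\<Phi> t))" and "X = \<xi> (\<Phi> t)"
    have X: "0 < X" "X < h" and w: "w > 0" "w\<^sup>2 = (r - X) / X"
      using \<xi> W[OF \<xi>] by (auto simp: X_def w_def)
    show "((\<lambda>t. \<xi> (\<Phi> t)) has_real_derivative - (sqrt h * (\<xi> (\<Phi> t))\<^sup>2 * \<delta> (\<Phi> t) / ((h - \<xi> (\<Phi> t)) * (1 + (\<xi> (\<Phi> t))\<^sup>2)))) (at t)"
      by (rule DERIV_cong[OF d\<xi>]) (simp add: g_def \<delta>_def)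
    have dW\<xi>: "((\<lambda>t. W (\<xi> (\<Phi> t))) has_real_derivative - r / (2 * X\<^sup>2 * w) * (\<rho> * sin (\<Phi> t) * g (\<Phi> t))) (at t)"
      unfolding w_def X_def by (rule DERIV_chain2[OF dW[OF \<xi>(1) \<xi>(2)] d\<xi>])
    have "((\<lambda>t. \<delta> (\<Phi> t)) has_real_derivative
       - (\<rho> * cos (\<Phi> t) * g (\<Phi> t)) * w - \<rho> * sin (\<Phi> t) * (- r / (2 * X\<^sup>2 * w) * (\<rho> * sin (\<Phi> t) * g (\<Phi> t)))) (at t)"
      unfolding \<delta>_def
      by (auto intro!: derivative_eq_intros \<Phi>(4) dW\<xi> simp: w_def algebra_simps)
    moreover have "- (\<rho> * cos (\<Phi> t) * g (\<Phi> t)) * w - \<rho> * sin (\<Phi> t) * (- r / (2 * X\<^sup>2 * w) * (\<rho> * sin (\<Phi> t) * g (\<Phi> t)))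
       = sqrt h * (X\<^sup>2 * (h - X) - 2 * h) / ((h - X) * (1 + X\<^sup>2))"
    proof -
      \<comment> \<open>After \<open>g (\<Phi> t) / w\<close> is factored out, the sine and
        \<open>w\<close> occur only squared, so the remaining factor is rational in
        \<open>X\<close>.\<close>
      have "- (\<rho> * cos (\<Phi> t) * g (\<Phi> t)) * w - \<rho> * sin (\<Phi> t) * (- r / (2 * X\<^sup>2 * w) * (\<rho> * sin (\<Phi> t) * g (\<Phi> t)))
        = g (\<Phi> t) / w * (- (\<rho> * cos (\<Phi> t)) * w\<^sup>2 + (\<rho> * sin (\<Phi> t))\<^sup>2 * r / (2 * X\<^sup>2))"
        using X w(1) by (simp add: field_simps power2_eq_square)
      also have "- (\<rho> * cos (\<Phi> t)) * w\<^sup>2 + (\<rho> * sin (\<Phi> t))\<^sup>2 * r / (2 * X\<^sup>2)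
         = - (2 * (m - X) * X * (r - X) - (\<rho>\<^sup>2 - (m - X)\<^sup>2) * r) / (2 * X\<^sup>2)"
        unfolding sc w(2) X_def[symmetric] using X by (simp add: field_simps power2_eq_square)
      also have "\<dots> = (X\<^sup>2 * (h - X) - 2 * h) / X\<^sup>2"
        unfolding key using X by (simp add: field_simps)
      also have "g (\<Phi> t) / w = sqrt h * X\<^sup>2 / ((h - X) * (1 + X\<^sup>2))"
        unfolding g_def w_def[symmetric] unfolding X_def[symmetric] using w by simp
      finally show ?thesis using X by simp
    qed
    ultimately show "((\<lambda>t. \<delta> (\<Phi> t)) has_real_derivative sqrt h * ((\<xi> (\<Phi> t))\<^sup>2 * (h - \<xi> (\<Phi> t)) - 2 * h) / ((h - \<xi> (\<Phi> t)) * (1 + (\<xi> (\<Phi> t))\<^sup>2))) (at t)"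
      by (simp add: X_def)
  qed (use \<Phi>(1-3) a \<xi> \<delta> in \<open>auto simp: \<xi>_def \<delta>_def\<close>)
qed

section \<open>Conservation of the integral and uniqueness of integral curves\<close>

text \<open>The sine is bounded by 1 and 1-Lipschitz, which gives the constant 4 for each component;
  the sum norm over three components gives 12.\<close>

lemma shape_dir_lipschitz: "norm (shape_dir s - shape_dir s') \<le> 12 * norm (s - s')"
proof -
  have sin: "\<bar>sin a - sin b\<bar> \<le> \<bar>a - b\<bar>" for a b :: real
  proof -
    have "\<bar>sin a - sin b\<bar> = 2 * \<bar>sin ((a - b) / 2)\<bar> * \<bar>cos ((a + b) / 2)\<bar>"
      by (simp add: sin_diff_sin abs_mult)
    also have "\<dots> \<le> 2 * \<bar>(a - b) / 2\<bar> * 1"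
      by (intro mult_mono abs_sin_x_le_abs_x) auto
    finally show ?thesis by simp
  qed
  have "\<bar>(shape_dir s - shape_dir s') $ i\<bar> \<le> 4 * norm (s - s')" for i
  proof -
    define a b c where "a = sin (s $ i)" and "b = sin (s $ (i - 1))" and "c = sin (s $ (i + 1))"
    define a' b' c' where "a' = sin (s' $ i)" and "b' = sin (s' $ (i - 1))" and "c' = sin (s' $ (i + 1))"
    have d: "\<bar>sin (s $ j) - sin (s' $ j)\<bar> \<le> norm (s - s')" for j
      using sin[of "s $ j" "s' $ j"] component_le_norm_cart[of "s - s'" j] by simp
    have "\<bar>a * (b - c) - a' * (b' - c')\<bar> = \<bar>(a - a') * (b - c) + a' * ((b - b') - (c - c'))\<bar>"
      by (simp add: algebra_simps)
    also have "\<dots> \<le> \<bar>a - a'\<bar> * \<bar>b - c\<bar> + \<bar>a'\<bar> * \<bar>(b - b') - (c - c')\<bar>"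
      by (simp add: abs_triangle_ineq flip: abs_mult)
    also have "\<dots> \<le> norm (s - s') * 2 + 1 * (norm (s - s') + norm (s - s'))"
    proof (intro add_mono mult_mono)
      show "\<bar>b - c\<bar> \<le> 2"
        using abs_sin_le_one[of "s $ (i - 1)"] abs_sin_le_one[of "s $ (i + 1)"]
        unfolding b_def c_def by linarith
      show "\<bar>b - b' - (c - c')\<bar> \<le> norm (s - s') + norm (s - s')"
        using d[of "i - 1"] d[of "i + 1"] unfolding b_def c_def b'_def c'_def by linarith
    qed (auto simp: a_def a'_def intro: d)
    finally show ?thesis
      by (simp add: shape_dir_def a_def b_def c_def a'_def b'_def c'_def)
  qed
  then have "(\<Sum>i\<in>UNIV. \<bar>(shape_dir s - shape_dir s') $ i\<bar>) \<le> (\<Sum>i\<in>(UNIV::3 set). 4 * norm (s - s'))"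
    by (intro sum_mono)
  then show ?thesis
    using norm_le_l1_cart[of "shape_dir s - shape_dir s'"] by (simp add: sum_3)
qed

lemma shape_space_bounds:
  assumes "s \<in> shape_space"
  shows "0 < s $ i" "s $ i < pi" "sin (s $ i) > 0" "cot (s $ i / 2) > 0"
proof -
  have "\<forall>i. 0 < s $ i \<and> s $ i < pi"
    using assms by (auto simp: shape_space_def forall_3)
  then show "0 < s $ i" "s $ i < pi" by auto
  then show "sin (s $ i) > 0" "cot (s $ i / 2) > 0"
    by (auto intro: sin_gt_zero cot_gt_zero)
qed

lemma cot_half_sum_pos: "s \<in> shape_space \<Longrightarrow> cot_half_sum s > 0"
  unfolding cot_half_sum_def by (intro sum_pos shape_space_bounds) auto

lemma has_vector_derivative_vec_iff:
  fixes c :: "real \<Rightarrow> real^'n"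
  shows "(c has_vector_derivative v) (at t) \<longleftrightarrow> (\<forall>i. ((\<lambda>t. c t $ i) has_real_derivative v $ i) (at t))"
  unfolding has_vector_derivative_def has_field_derivative_def
  by (subst has_derivative_componentwise_within) (auto simp: Basis_vec_def inner_axis mult.commute[of _ "v $ _"] mult_commute_abs)

text \<open>The product form is differentiated: its factors have logarithmic derivatives
  \<open>- k t * \<Delta> i t\<close>. The factor \<open>k t\<close> is common to all three, and the
  \<open>\<Delta> i t\<close> cancel cyclically.\<close>

lemma cot_half_sum_constant:
  assumes "integral_curve shape_field shape_space J c"
  shows "\<exists>h. \<forall>t\<in>J. cot_half_sum (c t) = h"
proof -
  have J: "convex J" and cS: "\<And>t. t \<in> J \<Longrightarrow> c t \<in> shape_space"
    and c: "\<And>t. t \<in> J \<Longrightarrow> (c has_vector_derivative shape_field (c t)) (at t)"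
    using assms by (auto simp: integral_curve_def is_interval_convex_1)
  define x where "x i t = cot (c t $ i / 2)" for i t
  define k where "k t = sqrt (cot_half_sum (c t)) / 2" for t
  define \<Delta> where "\<Delta> i t = sin (c t $ (i - 1)) - sin (c t $ (i + 1))" for i t
  have x: "(x i has_real_derivative - (k t * x i t * \<Delta> i t)) (at t)" if t: "t \<in> J" for i t
  proof -
    have "((\<lambda>t. c t $ i) has_real_derivative k t * (sin (c t $ i) * \<Delta> i t)) (at t)"
      using c[OF t] shape_field_eq[OF cS[OF t]]
      by (simp add: has_vector_derivative_vec_iff shape_dir_def k_def \<Delta>_def)
    then have 1: "((\<lambda>t. c t $ i / 2) has_real_derivative k t * (sin (c t $ i) * \<Delta> i t) / 2) (at t)"
      by (rule DERIV_cdivide)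
    have s: "sin (c t $ i / 2) \<noteq> 0"
      using sin_gt_zero[of "c t $ i / 2"] shape_space_bounds(1,2)[OF cS[OF t], of i] by auto
    have "sin (c t $ i) = 2 * sin (c t $ i / 2) * cos (c t $ i / 2)"
      using sin_double[of "c t $ i / 2"] by simp
    then have "- inverse ((sin (c t $ i / 2))\<^sup>2) * (k t * (sin (c t $ i) * \<Delta> i t) / 2) = - (k t * x i t * \<Delta> i t)"
      using s by (simp add: x_def cot_def field_simps power2_eq_square)
    from DERIV_cong[OF DERIV_chain2[OF DERIV_cot[OF s] 1] this] show ?thesis by (simp add: x_def[abs_def])
  qed
  have "((\<lambda>t. x 1 t * x 2 t * x 3 t) has_real_derivative 0) (at t within J)" if "t \<in> J" for t
    by (rule has_field_derivative_at_within, rule DERIV_cong[OF DERIV_mult[OF DERIV_mult[OF x[OF that] x[OF that]] x[OF that]]])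
      (simp only: \<Delta>_def cyclic3, simp add: algebra_simps)
  from has_field_derivative_zero_constant[OF J this]
  show ?thesis using cS by (simp add: cot_half_sum_eq_prod x_def)
qed

text \<open>
  The factor \<^term>\<open>sqrt (cot_half_sum s)\<close> of the field is constant along integral curves, and the
  other factor is globally Lipschitz.
\<close>

lemma integral_curve_unique:
  assumes c: "integral_curve shape_field shape_space J c"
    and d: "integral_curve shape_field shape_space J' d"
    and sub: "J \<subseteq> J'" and t0: "t0 \<in> J" "c t0 = d t0" and t: "t \<in> J"
  shows "c t = d t"
proof -
  obtain h where h: "\<And>t. t \<in> J \<Longrightarrow> cot_half_sum (c t) = h"
    using cot_half_sum_constant[OF c] by blast
  obtain h' where h': "\<And>t. t \<in> J' \<Longrightarrow> cot_half_sum (d t) = h'"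
    using cot_half_sum_constant[OF d] by blast
  have "h' = h" using h[OF t0(1)] h'[of t0] t0 sub by auto
  define F where "F s = (sqrt h / 2) *\<^sub>R shape_dir s" for s
  show ?thesis
  proof (rule lipschitz_ode_unique[where F=F and L="\<bar>sqrt h / 2\<bar> * 12"])
    show "is_interval J" using c by (simp add: integral_curve_def)
    show "norm (F x - F y) \<le> \<bar>sqrt h / 2\<bar> * 12 * norm (x - y)" for x y
    proof -
      have "norm (F x - F y) = \<bar>sqrt h / 2\<bar> * norm (shape_dir x - shape_dir y)"
        by (simp only: F_def norm_scaleR flip: scaleR_diff_right)
      also have "\<dots> \<le> \<bar>sqrt h / 2\<bar> * (12 * norm (x - y))"
        by (intro mult_left_mono shape_dir_lipschitz) auto
      finally show ?thesis by simp
    qed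
    show "(c has_vector_derivative F (c s)) (at s)" if "s \<in> J" for s
      using that c h[OF that] shape_field_eq[of "c s"] unfolding integral_curve_def F_def by auto
    show "(d has_vector_derivative F (d s)) (at s)" if "s \<in> J" for s
    proof -
      have "d s \<in> shape_space" "(d has_vector_derivative shape_field (d s)) (at s)" "cot_half_sum (d s) = h"
        using d h'[of s] that sub \<open>h' = h\<close> by (auto simp: integral_curve_def)
      then show ?thesis by (simp add: F_def shape_field_eq)
    qed
  qed (use t0 t in auto)
qed

section \<open>Half-angle cotangents as coordinates on the shape space\<close>

text \<open>On positive numbers \<open>arctan (1 / x)\<close> serves as the inverse of
  \<open>cot\<close>, and doubling the angle makes the sine rational in \<open>x\<close>.\<close>

lemma sin_cot_arccot:
  fixes x :: real
  assumes "x > 0"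
  defines "a \<equiv> 2 * arctan (1 / x)"
  shows "0 < a" "a < pi" "sin a = 2 * x / (1 + x\<^sup>2)" "cot (arctan (1 / x)) = x"
proof -
  show "0 < a" "a < pi" using assms arctan_ubound[of "1 / x"] by (auto simp: zero_less_arctan_iff)
  show "cot (arctan (1 / x)) = x" by (simp add: cot_altdef tan_arctan)
  have "sqrt (1 + (1 / x)\<^sup>2) * sqrt (1 + (1 / x)\<^sup>2) = 1 + (1 / x)\<^sup>2"
    by (rule real_sqrt_mult_self[THEN trans]) simp
  then have "sin a = 2 * (1 / x) / (1 + (1 / x)\<^sup>2)"
    using sin_double[of "arctan (1 / x)"] by (simp add: a_def sin_arctan cos_arctan)
  then show "sin a = 2 * x / (1 + x\<^sup>2)"
    using assms(1) by (simp add: field_simps power2_eq_square)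
qed

text \<open>Converse to \<open>cot_half_sum_eq_prod\<close>: the constraint makes the cosine of the
  sum of the half angles vanish, so the doubled sum has cosine -1 and \<open>sum_eq_pi\<close>
  applies.\<close>

lemma arccot_in_shape_space:
  fixes x y z :: real
  assumes "x > 0" "y > 0" "z > 0" "x * y * z = x + y + z"
  shows "vector [2 * arctan (1 / x), 2 * arctan (1 / y), 2 * arctan (1 / z)] \<in> shape_space"
proof -
  define a b c where "a = arctan (1 / x)" "b = arctan (1 / y)" "c = arctan (1 / z)"
  have C: "cos a > 0" "cos b > 0" "cos c > 0" by (simp_all add: a_b_c_def cos_arctan add_pos_nonneg)
  have S: "sin a = cos a / x" "sin b = cos b / y" "sin c = cos c / z"
    using C by (simp_all add: a_b_c_def sin_arctan cos_arctan)
  have "cos (a + b + c) = cos a * cos b * cos c * (1 - (1 / (x * y) + 1 / (x * z) + 1 / (y * z)))"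
    by (simp add: cos_add sin_add S algebra_simps)
  also have "1 / (x * y) + 1 / (x * z) + 1 / (y * z) = (x + y + z) / (x * y * z)"
    using assms(1-3) by (simp add: field_simps)
  also have "\<dots> = 1" using assms by simp
  finally have "cos (a + b + c) = 0" by simp
  then have "cos (2 * a + 2 * b + 2 * c) = - 1"
    using cos_double_cos[of "a + b + c"] by (simp add: algebra_simps)
  then have "2 * a + 2 * b + 2 * c = pi"
    by (intro sum_eq_pi) (use sin_cot_arccot(1,2)[OF assms(1)] sin_cot_arccot(1,2)[OF assms(2)]
      sin_cot_arccot(1,2)[OF assms(3)] in \<open>auto simp: a_b_c_def\<close>)
  then show ?thesis
    using sin_cot_arccot(1)[OF assms(1)] sin_cot_arccot(1)[OF assms(2)] sin_cot_arccot(1)[OF assms(3)]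
    by (simp add: shape_space_def a_b_c_def)
qed

text \<open>The constraint gives \<open>x * (y * z - 1) = y + z\<close>, hence
  \<open>(1 + y^2) * (1 + z^2) = (y * z - 1)^2 * (1 + x^2)\<close>. On the right \<open>y\<close>
  and \<open>z\<close> occur only through their sum and difference, which are \<open>h - X\<close>
  and \<open>D\<close> on a level curve.\<close>

lemma sin_arccot_diff:
  fixes x y z :: real
  assumes "x > 0" "y > 0" "z > 0" "x * y * z = x + y + z"
  shows "2 * z / (1 + z\<^sup>2) - 2 * y / (1 + y\<^sup>2) = 2 * x * (y - z) / ((y + z) * (1 + x\<^sup>2))"
proof -
  have 1: "x * (y * z - 1) = y + z" using assms(4) by (simp add: algebra_simps)
  then have p: "y * z - 1 > 0" using assms(1-3) by (metis add_pos_pos zero_less_mult_pos)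
  have "2 * z / (1 + z\<^sup>2) - 2 * y / (1 + y\<^sup>2) = 2 * (y - z) * (y * z - 1) / ((1 + y\<^sup>2) * (1 + z\<^sup>2))"
    by (simp add: divide_simps add_nonneg_eq_0_iff) (simp add: algebra_simps power2_eq_square)
  also have "(1 + y\<^sup>2) * (1 + z\<^sup>2) = (y * z - 1)\<^sup>2 + (y + z)\<^sup>2" by algebra
  also have "\<dots> = (y * z - 1) * ((y * z - 1) * (1 + x\<^sup>2))" unfolding 1[symmetric] by algebra
  also have "2 * (y - z) * (y * z - 1) / ((y * z - 1) * ((y * z - 1) * (1 + x\<^sup>2))) = 2 * x * (y - z) / ((x * (y * z - 1)) * (1 + x\<^sup>2))"
    using p assms(1) by simp
  finally show ?thesis unfolding 1 .
qed

text \<open>Under the constraint \<open>u / ((v + w) * (1 + u^2))\<close> takes the same value when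
  \<open>u\<close> and \<open>v\<close> are exchanged. This brings the velocities of the three
  cotangents over one denominator.\<close>

lemma arccot_velocity_swap:
  fixes u v w :: real
  assumes "u > 0" "v > 0" "w > 0" "u * v * w = u + v + w"
  shows "u * v * (u - w) / ((v + w) * (1 + u\<^sup>2)) = v\<^sup>2 * (u - w) / ((w + u) * (1 + v\<^sup>2))"
proof -
  have "u * (w + u) * (1 + v\<^sup>2) - v * (v + w) * (1 + u\<^sup>2) = (u - v) * (u + v + w - u * v * w)"
    by algebra
  then have e: "u * ((w + u) * (1 + v\<^sup>2)) = v * ((v + w) * (1 + u\<^sup>2))" using assms(4) by simp
  have "1 + u\<^sup>2 > 0" "1 + v\<^sup>2 > 0" by (simp_all add: add_pos_nonneg)
  then have n: "(v + w) * (1 + u\<^sup>2) \<noteq> 0" "(w + u) * (1 + v\<^sup>2) \<noteq> 0" using assms(1-3) by auto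
  have "u * v * (u - w) * ((w + u) * (1 + v\<^sup>2)) = v\<^sup>2 * (u - w) * ((v + w) * (1 + u\<^sup>2))"
    using e by algebra
  then show ?thesis using frac_eq_eq[OF n] by blast
qed

text \<open>The equality case of the inequality of arithmetic and geometric means: the constraint
  turns the bound into \<open>(x + y + z)^3 \<le> 27 * x * y * z\<close>, and the difference of the
  two sides is a positive combination of squares.\<close>

lemma amgm_equality:
  fixes x y z :: real
  assumes "x > 0" "y > 0" "z > 0" "x * y * z = x + y + z" "(x + y + z)\<^sup>2 \<le> 27"
  shows "x = y" "y = z"
proof -
  have "(x + y + z) * (x + y + z)\<^sup>2 \<le> (x + y + z) * 27"
    using assms by (intro mult_left_mono) auto
  then have 1: "(x + y + z) * (x + y + z)\<^sup>2 - 27 * (x * y * z) \<le> 0" using assms(4) by simp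
  have 2: "(x + y + z) * (x + y + z)\<^sup>2 - 27 * (x * y * z) =
      (x + y + z) / 2 * ((x - y)\<^sup>2 + (y - z)\<^sup>2 + (z - x)\<^sup>2)
      + 3 * (x * (y - z)\<^sup>2 + y * (z - x)\<^sup>2 + z * (x - y)\<^sup>2)"
    by (simp add: field_simps power2_eq_square)
  have 3: "x * (y - z)\<^sup>2 + y * (z - x)\<^sup>2 + z * (x - y)\<^sup>2 \<ge> 0" using assms by simp
  have "b \<le> 0" if "a \<le> 0" "a = b + 3 * c" "c \<ge> 0" for a b c :: real
    using that by linarith
  from this[OF 1 2 3]
  have "(x + y + z) / 2 * ((x - y)\<^sup>2 + (y - z)\<^sup>2 + (z - x)\<^sup>2) \<le> 0" .
  then have "(x - y)\<^sup>2 + (y - z)\<^sup>2 + (z - x)\<^sup>2 \<le> 0"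
    using assms by (simp add: mult_le_0_iff)
  then have "(x - y)\<^sup>2 \<le> 0" "(y - z)\<^sup>2 \<le> 0"
    using zero_le_power2[of "x - y"] zero_le_power2[of "y - z"] zero_le_power2[of "z - x"] by linarith+
  then show "x = y" "y = z" by auto
qed

text \<open>The sines of the angles are positive, so at a zero they all agree. Two angles of a
  triangle add up to less than pi, which excludes supplementary angles and leaves equal
  ones.\<close>

lemma shape_field_zero_iff:
  assumes "s \<in> shape_space"
  shows "shape_field s = 0 \<longleftrightarrow> s $ 1 = s $ 2 \<and> s $ 2 = s $ 3"
proof
  note b = shape_space_bounds[OF assms]
  assume "shape_field s = 0"
  then have "shape_dir s = 0"
    using cot_half_sum_pos[OF assms] by (simp add: shape_field_eq[OF assms])
  then have "sin (s $ (i - 1)) = sin (s $ (i + 1))" for i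
    using b(3)[of i] by (auto simp: shape_dir_def vec_eq_iff dest: spec[of _ i])
  from this[of 3] this[of 1] have sn: "sin (s $ 1) = sin (s $ 2)" "sin (s $ 2) = sin (s $ 3)"
    unfolding cyclic3 by simp_all
  have less: "sin x < sin y" if "x < y" "x > 0" "x + y < pi" for x y :: real
  proof -
    have "sin ((y - x) / 2) > 0" using that by (intro sin_gt_zero) auto
    moreover have "cos ((y + x) / 2) > 0" using that by (intro cos_gt_zero) auto
    ultimately have "2 * sin ((y - x) / 2) * cos ((y + x) / 2) > 0" by simp
    then show ?thesis using sin_diff_sin[of y x] by linarith
  qed
  have inj: "x = y" if "sin x = sin y" "x > 0" "y > 0" "x + y < pi" for x y :: real
    using less[of x y] less[of y x] that by (cases x y rule: linorder_cases) (auto simp: add.commute)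
  have "s $ 1 + s $ 2 + s $ 3 = pi" using assms by (simp add: shape_space_def)
  then show "s $ 1 = s $ 2 \<and> s $ 2 = s $ 3"
    using b(1)[of 1] b(1)[of 2] b(1)[of 3] inj[OF sn(1)] inj[OF sn(2)] by linarith
next
  assume "s $ 1 = s $ 2 \<and> s $ 2 = s $ 3"
  then have "\<forall>i. sin (s $ (i - 1)) = sin (s $ (i + 1))"
    unfolding forall_3 cyclic3 by simp
  then show "shape_field s = 0"
    by (simp add: shape_field_eq[OF assms] shape_dir_def vec_eq_iff)
qed

section \<open>A periodic integral curve through every shape\<close>

text \<open>For \<open>h^2 \<le> 27\<close> the shape is equilateral and the constant curve serves.
  Otherwise the level curve solution for \<open>X\<close> and \<open>D\<close> determines the other
  two cotangents, and \<open>arctan\<close> leads back to the angles.\<close>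

lemma periodic_integral_curve:
  assumes s: "s \<in> shape_space"
  obtains c T where "T > 0" "\<And>t. c (t + T) = c t" "c 0 = s"
    "integral_curve shape_field shape_space UNIV c"
proof -
  define x y z h where "x = cot (s $ 1 / 2)" and "y = cot (s $ 2 / 2)" and "z = cot (s $ 3 / 2)"
    and "h = cot_half_sum s"
  have pos: "x > 0" "y > 0" "z > 0" using shape_space_bounds(4)[OF s] by (auto simp: x_def y_def z_def)
  have h: "x + y + z = h" "x * y * z = h"
    using cot_half_sum_eq_prod[OF s] by (auto simp: cot_half_sum_def sum_3 x_def y_def z_def h_def)
  have arc: "2 * arctan (1 / cot (s $ i / 2)) = s $ i" for i
  proof -
    have "1 / cot (s $ i / 2) = tan (s $ i / 2)" by (simp add: cot_def tan_def)
    then show ?thesis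
      using arctan_tan[of "s $ i / 2"] shape_space_bounds(1,2)[OF s, of i] by simp
  qed
  show ?thesis
  proof (cases "h\<^sup>2 \<le> 27")
    case True
    have "x * y * z = x + y + z" "(x + y + z)\<^sup>2 \<le> 27" by (simp_all only: h True)
    then have "x = y" "y = z" using amgm_equality[OF pos] by blast+
    moreover have "s $ 1 = 2 * arctan (1 / x)" "s $ 2 = 2 * arctan (1 / y)" "s $ 3 = 2 * arctan (1 / z)"
      by (simp_all only: arc x_def y_def z_def)
    ultimately have "s $ 1 = s $ 2 \<and> s $ 2 = s $ 3" by (simp only:)
    then have "shape_field s = 0" using shape_field_zero_iff[OF s] by simp
    then show ?thesis
      by (intro that[of 1 "\<lambda>_. s"]) (auto simp: integral_curve_def s)
  next
    case False
    have hp: "h > 0" using pos h by linarith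
    have xh: "x < h" using pos h by linarith
    have d: "(y - z)\<^sup>2 = (h - x)\<^sup>2 - 4 * h / x"
    proof -
      have 1: "4 * h / x = 4 * (y * z)" using h(2) pos by (simp add: field_simps)
      have 2: "h - x = y + z" using h(1) by simp
      show ?thesis unfolding 1 2 by algebra
    qed
    have h27: "27 < h\<^sup>2" using False by simp
    obtain X D T where T: "T > 0" "\<And>t. X (t + T) = X t" "\<And>t. D (t + T) = D t"
      and ini: "X 0 = x" "D 0 = y - z"
      and X: "\<And>t. 0 < X t" "\<And>t. X t < h" and D: "\<And>t. (D t)\<^sup>2 = (h - X t)\<^sup>2 - 4 * h / X t"
      and dX: "\<And>t. (X has_real_derivative - (sqrt h * (X t)\<^sup>2 * D t / ((h - X t) * (1 + (X t)\<^sup>2)))) (at t)"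
      and dD: "\<And>t. (D has_real_derivative sqrt h * ((X t)\<^sup>2 * (h - X t) - 2 * h) / ((h - X t) * (1 + (X t)\<^sup>2))) (at t)"
      by (rule level_curve_solution[OF hp h27 pos(1) xh d], rule that)
    \<comment> \<open>The two numbers with sum \<open>h - X t\<close> and difference
      \<open>D t\<close>.\<close>
    define Y Z where "Y t = (h - X t + D t) / 2" and "Z t = (h - X t - D t) / 2" for t
    have sum: "X t + Y t + Z t = h" for t by (simp add: Y_def Z_def field_simps)
    have YZ: "Y t + Z t = h - X t" "Y t - Z t = D t" for t by (simp_all add: Y_def Z_def field_simps)
    have YZp: "Y t * Z t = h / X t" for t
    proof -
      have "Y t * Z t = ((h - X t)\<^sup>2 - (D t)\<^sup>2) / 4" by (simp add: Y_def Z_def power2_eq_square field_simps)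
      then show ?thesis by (simp add: D)
    qed
    have prod: "X t * Y t * Z t = h" for t using YZp[of t] X[of t] by (simp add: field_simps)
    have posYZ: "Y t > 0" "Z t > 0" for t
    proof -
      have "Y t * Z t > 0" "Y t + Z t > 0" using X[of t] hp by (simp_all add: YZp YZ)
      then show "Y t > 0" "Z t > 0" by (auto simp: zero_less_mult_iff)
    qed
    have cyc: "X t * Y t * Z t = X t + Y t + Z t" "Y t * Z t * X t = Y t + Z t + X t"
      "Z t * X t * Y t = Z t + X t + Y t" "X t * Z t * Y t = X t + Z t + Y t" for t
    proof -
      show "X t * Y t * Z t = X t + Y t + Z t" by (simp only: sum prod)
      then show "Y t * Z t * X t = Y t + Z t + X t" "Z t * X t * Y t = Z t + X t + Y t"
        "X t * Z t * Y t = X t + Z t + Y t" by algebra+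
    qed
    define k where "k = sqrt h / 2"
    define S where "S x = 2 * x / (1 + x\<^sup>2)" for x :: real
    have SX: "S (Z t) - S (Y t) = 2 * X t * (Y t - Z t) / ((Y t + Z t) * (1 + (X t)\<^sup>2))"
      and SY: "S (X t) - S (Z t) = 2 * Y t * (Z t - X t) / ((Z t + X t) * (1 + (Y t)\<^sup>2))"
      and SZ: "S (Y t) - S (X t) = 2 * Z t * (X t - Y t) / ((X t + Y t) * (1 + (Z t)\<^sup>2))" for t
      unfolding S_def by (intro sin_arccot_diff X posYZ cyc)+
    have dX': "(X has_real_derivative - (k * X t * (S (Z t) - S (Y t)))) (at t)" for t
      by (rule DERIV_cong[OF dX]) (simp add: SX YZ k_def power2_eq_square)
    have neg: "y * (2 * y * (z - x) / r) = - (2 * (y\<^sup>2 * (x - z) / r))" for x y z r :: real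
      by (cases "r = 0") (simp_all add: field_simps power2_eq_square)
    have Yt: "Y t * (S (X t) - S (Z t)) = - (2 * (X t * Y t * (X t - Z t) / ((Y t + Z t) * (1 + (X t)\<^sup>2))))" for t
      unfolding SY neg by (subst arccot_velocity_swap) (intro X posYZ cyc refl)+
    have dY': "(Y has_real_derivative - (k * Y t * (S (X t) - S (Z t)))) (at t)" for t
    proof -
      have e: "(X t)\<^sup>2 * (h - X t) - 2 * h + (X t)\<^sup>2 * D t = 2 * (X t * Y t * (X t - Z t))"
      proof -
        have "x\<^sup>2 * (y + z) - 2 * (x * y * z) + x\<^sup>2 * (y - z) = 2 * (x * y * (x - z))" for x y z :: real
          by (simp add: algebra_simps power2_eq_square)
        from this[of "X t" "Y t" "Z t"] show ?thesis unfolding YZ prod .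
      qed
      \<comment> \<open>The left side, including \<open>0 - -\<close>, has the shape produced by the
        derivative rules, so that the fact applies by unification below.\<close>
      have f: "(0 - - (a * b * c / q) + a * d / q) / 2 = - (a / 2 * - (2 * (p / q)))"
        if "d + b * c = 2 * p" for a b c d p q :: real
      proof -
        have "(0 - - (a * b * c / q) + a * d / q) / 2 = a * (d + b * c) / q / 2"
          by (simp add: distrib_left add_divide_distrib)
        then show ?thesis unfolding that by simp
      qed
      have 1: "Y = (\<lambda>t. (h - X t + D t) / 2)" by (simp add: Y_def fun_eq_iff)
      show ?thesis
        unfolding k_def mult.assoc Yt unfolding 1
        by (rule DERIV_cong[OF DERIV_cdivide[OF DERIV_add[OF DERIV_diff[OF DERIV_const dX] dD]]])
          (unfold 1[symmetric, THEN fun_cong], unfold YZ(1), rule f, rule e[unfolded mult.assoc])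
    qed
    have dZ': "(Z has_real_derivative - (k * Z t * (S (Y t) - S (X t)))) (at t)" for t
    proof -
      have Z: "Z = (\<lambda>t. h - X t - Y t)" by (auto simp: fun_eq_iff Y_def Z_def field_simps)
      have dZ: "(Z has_real_derivative (k * X t * (S (Z t) - S (Y t)) + k * Y t * (S (X t) - S (Z t)))) (at t)"
        unfolding Z by (auto intro!: derivative_eq_intros dX' dY' simp: Z)
      \<comment> \<open>Consistency with \<open>X + Y + Z = h\<close>:
        \<open>arccot_velocity_swap\<close> puts the three terms over the common denominator
        \<open>q\<close>, where the numerators cancel identically.\<close>
      have z0: "X t * (S (Z t) - S (Y t)) + Y t * (S (X t) - S (Z t)) + Z t * (S (Y t) - S (X t)) = 0"
      proof -
        define q where "q = (Y t + Z t) * (1 + (X t)\<^sup>2)"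
        have y: "Y t * (S (X t) - S (Z t)) = - (2 * (X t * Y t * (X t - Z t) / q))"
          unfolding q_def by (rule Yt)
        have p: "z * (2 * z * d / r) = 2 * (z\<^sup>2 * d / r)" for z d r :: real
          by (simp add: power2_eq_square)
        have "(Z t)\<^sup>2 * (X t - Y t) / ((Y t + X t) * (1 + (Z t)\<^sup>2)) = X t * Z t * (X t - Y t) / q"
          unfolding q_def add.commute[of "Y t" "Z t"] by (rule arccot_velocity_swap[symmetric]) (intro X posYZ cyc)+
        then have z: "Z t * (S (Y t) - S (X t)) = 2 * (X t * Z t * (X t - Y t) / q)"
          unfolding SZ p add.commute[of "X t" "Y t"] by (simp only:)
        have x: "X t * (S (Z t) - S (Y t)) = 2 * (X t * X t * (Y t - Z t) / q)"
          unfolding SX q_def by simp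
        have "2 * (a * a * (b - c) / q) + - (2 * (a * b * (a - c) / q)) + 2 * (a * c * (a - b) / q) = 0" for a b c :: real
          by (cases "q = 0") (simp_all add: field_simps)
        then show ?thesis unfolding x y z .
      qed
      have "k * x * a + k * y * b = - (k * z * c)" if "x * a + y * b + z * c = 0" for a b c x y z :: real
      proof -
        have "k * (x * a + y * b + z * c) = 0" using that by simp
        then show ?thesis by (simp add: algebra_simps)
      qed
      from DERIV_cong[OF dZ this[OF z0]] show ?thesis .
    qed
    define c :: "real \<Rightarrow> real^3" where
      "c t = vector [2 * arctan (1 / X t), 2 * arctan (1 / Y t), 2 * arctan (1 / Z t)]" for t
    have cS: "c t \<in> shape_space" for t
      unfolding c_def by (rule arccot_in_shape_space) (use X posYZ sum prod in auto)
    have ch: "cot_half_sum (c t) = h" for t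
      using sin_cot_arccot(4) X posYZ sum[of t] by (simp add: cot_half_sum_def sum_3 c_def)
    \<comment> \<open>Each cotangent satisfies \<open>U' = - k * U * \<Delta>\<close>; the chain
      rule turns this into the corresponding component of the field, because \<open>S (U t)\<close>
      is the sine of the angle.\<close>
    have darc: "((\<lambda>t. 2 * arctan (1 / U t)) has_real_derivative k * (S (U t) * \<Delta>)) (at t)"
      if "(U has_real_derivative - (k * U t * \<Delta>)) (at t)" "U t > 0" for U \<Delta> t
      by (rule derivative_eq_intros that(1) refl | use that(2) in force)+
        (use that(2) in \<open>simp add: S_def field_simps power2_eq_square\<close>)
    have sn: "sin (c t $ 1) = S (X t)" "sin (c t $ 2) = S (Y t)" "sin (c t $ 3) = S (Z t)" for t
      using X posYZ by (simp_all add: c_def sin_cot_arccot(3) S_def)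
    have "(c has_vector_derivative shape_field (c t)) (at t)" for t
    proof -
      have "\<forall>i. shape_field (c t) $ i = k * (sin (c t $ i) * (sin (c t $ (i - 1)) - sin (c t $ (i + 1))))"
        by (simp add: shape_field_eq[OF cS] ch k_def shape_dir_def)
      then show ?thesis
        unfolding has_vector_derivative_vec_iff forall_3 cyclic3 sn
        using darc[OF dX'] darc[OF dY'] darc[OF dZ'] X posYZ by (simp add: c_def)
    qed
    then have "integral_curve shape_field shape_space UNIV c"
      by (simp add: integral_curve_def cS)
    moreover have "c (t + T) = c t" for t by (simp add: c_def T Y_def Z_def)
    moreover have "c 0 = s"
    proof -
      have "Y 0 = y" "Z 0 = z" using h(1) by (simp_all add: Y_def Z_def ini field_simps)
      then show ?thesis
        using arc by (simp add: c_def ini vec_eq_iff forall_3 x_def y_def z_def)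
    qed
    ultimately show ?thesis using that T(1) by blast
  qed
qed

section \<open>Maximal integral curves are closed\<close>

lemma integral_curve_shift:
  assumes "integral_curve X S UNIV c"
  shows "integral_curve X S UNIV (\<lambda>t. c (t - a))"
proof -
  have "((\<lambda>t. c (t - a)) has_vector_derivative X (c (t - a))) (at t)" for t
  proof -
    have 1: "((\<lambda>t. t - a) has_vector_derivative 1) (at t)"
      by (auto intro!: derivative_eq_intros)
    have "(c has_vector_derivative X (c (t - a))) (at (t - a))"
      using assms by (simp add: integral_curve_def)
    from vector_diff_chain_at[OF 1 this] show ?thesis by (simp add: o_def)
  qed
  then show ?thesis using assms by (simp add: integral_curve_def)
qed

lemma trajectory_UNIV: "integral_curve X S UNIV c \<Longrightarrow> trajectory X S UNIV c"
  by (auto simp: trajectory_def)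

text \<open>The periodic curve through one point of the trajectory, shifted in time, agrees with it
  on \<open>J\<close> by uniqueness and so extends it to the whole line. Maximality forces
  \<open>J = UNIV\<close>.\<close>

lemma trajectory_closed:
  assumes tr: "trajectory shape_field shape_space J c"
  shows "closed_trajectory J c"
proof -
  have ic: "integral_curve shape_field shape_space J c" using tr by (simp add: trajectory_def)
  then obtain t0 where t0: "t0 \<in> J" "c t0 \<in> shape_space" by (auto simp: integral_curve_def)
  obtain d T where d: "T > 0" "\<And>t. d (t + T) = d t" "d 0 = c t0"
    "integral_curve shape_field shape_space UNIV d"
    using periodic_integral_curve[OF t0(2)] by metis
  define e where "e t = d (t - t0)" for t
  have e: "integral_curve shape_field shape_space UNIV e"
    unfolding e_def[abs_def] by (rule integral_curve_shift[OF d(4)])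
  have eq: "c t = e t" if "t \<in> J" for t
    by (rule integral_curve_unique[OF ic e _ t0(1) _ that]) (auto simp: e_def d(3))
  then have "J = UNIV" using tr e unfolding trajectory_def by (metis subset_UNIV)
  moreover have "c (t + T) = c t" for t
  proof -
    have "e (t + T) = e t" using d(2)[of "t - t0"] by (simp add: e_def algebra_simps)
    then show ?thesis using eq \<open>J = UNIV\<close> by simp
  qed
  ultimately show ?thesis using d(1) by (auto simp: closed_trajectory_def)
qed

theorem lemma4p2:
  shows
    \<comment> \<open>the induced field is well defined\<close>
    "(\<forall>P\<in>unit_triangles. angles differentiable (at P) \<and>
        shape_field (angles P) = frechet_derivative angles (at P) (xi P)) \<and>
     (\<forall>P. nondegenerate P \<longrightarrow>
        angles P \<in> shape_space \<and>
        shape_I (angles P) = (perimeter P)\<^sup>2 / (4 * area P)) \<and>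
     (\<forall>\<alpha> \<beta> \<gamma>. vector [\<alpha>, \<beta>, \<gamma>] \<in> shape_space \<longrightarrow>
        shape_I (vector [\<alpha>, \<beta>, \<gamma>]) = cot (\<alpha>/2) + cot (\<beta>/2) + cot (\<gamma>/2) \<and>
        shape_I (vector [\<alpha>, \<beta>, \<gamma>]) = cot (\<alpha>/2) * cot (\<beta>/2) * cot (\<gamma>/2)) \<and>
     first_integral shape_field shape_space shape_I \<and>
     {s \<in> shape_space. shape_field s = 0} = {vector [pi/3, pi/3, pi/3]} \<and>
     (\<forall>s\<in>shape_space. \<exists>J c. trajectory shape_field shape_space J c \<and> s \<in> c ` J) \<and>
     (\<forall>J c. trajectory shape_field shape_space J c \<longrightarrow> closed_trajectory J c)"
proof (intro conjI ballI allI impI)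
  show "angles differentiable (at P)"
    "shape_field (angles P) = frechet_derivative angles (at P) (xi P)" if "P \<in> unit_triangles" for P
    using shape_field_angles[OF that] by simp_all
  show "angles P \<in> shape_space" "shape_I (angles P) = (perimeter P)\<^sup>2 / (4 * area P)"
    if "nondegenerate P" for P
    using angles_triangle[OF that] shape_I_angles[OF that] by simp_all
  show "shape_I (vector [\<alpha>, \<beta>, \<gamma>]) = cot (\<alpha>/2) + cot (\<beta>/2) + cot (\<gamma>/2)"
    "shape_I (vector [\<alpha>, \<beta>, \<gamma>]) = cot (\<alpha>/2) * cot (\<beta>/2) * cot (\<gamma>/2)"
    if "vector [\<alpha>, \<beta>, \<gamma>] \<in> shape_space" for \<alpha> \<beta> \<gamma>
    using shape_I_eq[OF that] cot_half_sum_eq_prod[OF that] by (simp_all add: cot_half_sum_def sum_3)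
  show "first_integral shape_field shape_space shape_I"
    unfolding first_integral_def
  proof (intro conjI allI impI notI)
    assume "shape_I constant_on shape_space"
    then obtain y where y: "\<And>s. s \<in> shape_space \<Longrightarrow> cot_half_sum s = y"
      unfolding constant_on_def using shape_I_eq by metis
    have I: "cot_half_sum (vector [2 * arctan (1 / a), 2 * arctan (1 / b), 2 * arctan (1 / c)]) = a + b + c"
      if "a > 0" "b > 0" "c > 0" for a b c
      using that by (simp add: cot_half_sum_def sum_3 sin_cot_arccot(4))
    \<comment> \<open>Two solutions \<open>(a, a, 2 * a / (a^2 - 1))\<close> of the constraint, for
      \<open>a = 3\<close> and \<open>a = 2\<close>; their sums 27/4 and 16/3 differ.\<close>
    show False
      using y[OF arccot_in_shape_space[of 3 3 "3/4"]] y[OF arccot_in_shape_space[of 2 2 "4/3"]]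
        I[of 3 3 "3/4"] I[of 2 2 "4/3"] by simp
  next
    fix J c assume c: "integral_curve shape_field shape_space J c"
    then show "(\<lambda>t. shape_I (c t)) constant_on J"
      using cot_half_sum_constant[OF c] shape_I_eq
      unfolding constant_on_def integral_curve_def by metis
  qed
  show "{s \<in> shape_space. shape_field s = 0} = {vector [pi/3, pi/3, pi/3]}"
  proof -
    have "s \<in> shape_space \<and> s $ 1 = s $ 2 \<and> s $ 2 = s $ 3 \<longleftrightarrow> s = vector [pi/3, pi/3, pi/3]" for s
    proof
      assume "s \<in> shape_space \<and> s $ 1 = s $ 2 \<and> s $ 2 = s $ 3"
      then have "s $ 1 = pi/3" "s $ 2 = pi/3" "s $ 3 = pi/3" by (auto simp: shape_space_def)
      then show "s = vector [pi/3, pi/3, pi/3]" by (simp add: vec_eq_iff forall_3)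
    qed (simp add: shape_space_def)
    then show ?thesis using shape_field_zero_iff by blast
  qed
  show "\<exists>J c. trajectory shape_field shape_space J c \<and> s \<in> c ` J" if "s \<in> shape_space" for s
    using periodic_integral_curve[OF that] trajectory_UNIV by (metis rangeI)
  show "closed_trajectory J c" if "trajectory shape_field shape_space J c" for J c
    using that by (rule trajectory_closed)
qed

end
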